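(* There is an algorithm that, given a unique sink orientation $O$ of the $n$-dimensional hypercube $Q_n$, computes all phases of $O$ (that is, for every $i\in[n]$ the partition of the set $E_i$ of $i$-edges into $i$-phases) in $O(3^n)$ time, using $O(3^n)$ vertex comparisons.
   Context: The $n$-cube $Q_n$ is the graph on $\{0,1\}^n$ where two vertices are adjacent iff they differ in exactly one coordinate; an edge whose endpoints differ in coordinate $i$ is an $i$-edge, and $E_i$ is the set of $i$-edges. A face of $Q_n$ is given by a string $f\in\{0,1,*\}^n$ and is the induced subgraph on all $v$ with $v_i=f_i$ or $f_i=*$ for every $i$. An orientation is a function $O:\{0,1\}^n\to\{0,1\}^n$ (outmap) such that $O(v)_i\ne O(v')_i$ whenever $v,v'$ differ exactly in coordinate $i$; $O(v)_i=1$ means the $i$-edge at $v$ is outgoing from $v$, and $O(v)_i=0$ means it is incoming. $O$ is a unique sink orientation (USO) if every face contains exactly one vertex with no outgoing edges inside the face. Phases: let $O$ be a USO. Two $i$-edges $e,e'\in E_i$ are in direct phase if there exist $v\in e$, $w\in e'$ such that $O(v)_j=O(w)_j$ for all $j\neq i$ with $v_j\ne w_j$; such a pair $v,w$ is said to certify that $e,e'$ are in direct phase. Two $i$-edges are in phase if they are linked by a finite sequence of $i$-edges in which consecutive edges are in direct phase. An $i$-phase is a maximal set of $i$-edges that are pairwise in phase, i.e., an equivalence class of $E_i$ under this relation; a phase is an $i$-phase for some $i\in[n]$. A vertex comparison means comparing a pair of vertices $v,w$ (via their outmaps $O(v),O(w)$) to find the edges, if any, that the pair certifies to be in direct phase.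 *)

theory Defs
  imports "HOL-Library.Landau_Symbols"
begin

unbundle bit_operations_syntax

section \<open>Unique sink orientations and phases\<close>

definition cube :: "nat \<Rightarrow> bool list set" where
  "cube n = {v. length v = n}"

definition differ_exactly :: "nat \<Rightarrow> nat \<Rightarrow> bool list \<Rightarrow> bool list \<Rightarrow> bool" where
  "differ_exactly n i v w \<longleftrightarrow> (\<forall>j<n. v ! j \<noteq> w ! j \<longleftrightarrow> j = i)"

definition i_edges :: "nat \<Rightarrow> nat \<Rightarrow> bool list set set" where
  "i_edges n i = {{v, w} | v w. v \<in> cube n \<and> w \<in> cube n \<and> differ_exactly n i v w}"

text \<open>In a face string, \<open>None\<close> stands for the symbol \<open>*\<close>.\<close>

definition face_vertices :: "nat \<Rightarrow> bool option list \<Rightarrow> bool list set" where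
  "face_vertices n f = {v \<in> cube n. \<forall>i<n. f ! i = Some (v ! i) \<or> f ! i = None}"

definition is_orientation :: "nat \<Rightarrow> (bool list \<Rightarrow> bool list) \<Rightarrow> bool" where
  "is_orientation n out \<longleftrightarrow>
     (\<forall>v\<in>cube n. out v \<in> cube n) \<and>
     (\<forall>v\<in>cube n. \<forall>w\<in>cube n. \<forall>i<n. differ_exactly n i v w \<longrightarrow> out v ! i \<noteq> out w ! i)"

definition is_uso :: "nat \<Rightarrow> (bool list \<Rightarrow> bool list) \<Rightarrow> bool" where
  "is_uso n out \<longleftrightarrow>
     is_orientation n out \<and>
     (\<forall>f. length f = n \<longrightarrow>
        (\<exists>!v. v \<in> face_vertices n f \<and> (\<forall>i<n. f ! i = None \<longrightarrow> \<not> out v ! i)))"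

definition certifies ::
    "nat \<Rightarrow> (bool list \<Rightarrow> bool list) \<Rightarrow> nat \<Rightarrow> bool list \<Rightarrow> bool list \<Rightarrow> bool" where
  "certifies n out i v w \<longleftrightarrow> (\<forall>j<n. j \<noteq> i \<and> v ! j \<noteq> w ! j \<longrightarrow> out v ! j = out w ! j)"

definition direct_phase ::
    "nat \<Rightarrow> (bool list \<Rightarrow> bool list) \<Rightarrow> nat \<Rightarrow> (bool list set \<times> bool list set) set" where
  "direct_phase n out i =
     {(e, e'). e \<in> i_edges n i \<and> e' \<in> i_edges n i \<and> (\<exists>v\<in>e. \<exists>w\<in>e'. certifies n out i v w)}"

definition in_phase ::
    "nat \<Rightarrow> (bool list \<Rightarrow> bool list) \<Rightarrow> nat \<Rightarrow> (bool list set \<times> bool list set) set" where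
  "in_phase n out i = {(e, e'). e \<in> i_edges n i \<and> (e, e') \<in> (direct_phase n out i)\<^sup>*}"

definition phases :: "nat \<Rightarrow> (bool list \<Rightarrow> bool list) \<Rightarrow> nat \<Rightarrow> bool list set set set" where
  "phases n out i = i_edges n i // in_phase n out i"

lemma equiv_in_phase: "equiv (i_edges n i) (in_phase n out i)"
proof -
  have sym_d: "sym (direct_phase n out i)"
    unfolding sym_def direct_phase_def certifies_def by auto
  have mem: "e' \<in> i_edges n i" if "(e, e') \<in> (direct_phase n out i)\<^sup>*" "e \<in> i_edges n i" for e e'
    using that by (induction rule: rtrancl_induct) (auto simp: direct_phase_def)
  have "sym ((direct_phase n out i)\<^sup>*)"
    using sym_d by (rule sym_rtrancl)
  then show ?thesis
    unfolding equiv_def refl_on_def sym_def trans_def in_phase_def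
    using mem by (auto intro: rtrancl_trans)
qed


section \<open>Vertices as machine words\<close>

text \<open>Coordinate \<open>i\<close> of a vertex is bit \<open>i\<close> of the word that encodes it.\<close>

definition word_of :: "bool list \<Rightarrow> nat" where
  "word_of v = horner_sum of_bool 2 v"

definition vertex_of :: "nat \<Rightarrow> nat \<Rightarrow> bool list" where
  "vertex_of n x = map (bit x) [0..<n]"

text \<open>
  The result of a vertex comparison: the set of all coordinates \<open>i\<close> such that the \<open>i\<close>-edges at the
  two vertices are certified to be in direct phase, as a bit mask.
\<close>

definition compare_vertices :: "nat \<Rightarrow> (bool list \<Rightarrow> bool list) \<Rightarrow> nat \<Rightarrow> nat \<Rightarrow> nat" where
  "compare_vertices n out x y =
     word_of (map (\<lambda>i. certifies n out i (vertex_of n x) (vertex_of n y)) [0..<n])"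

lemma bit_word_of: "bit (word_of v) i \<longleftrightarrow> i < length v \<and> v ! i"
  by (simp add: word_of_def bit_horner_sum_bit_iff)

lemma power_of_2_iff_and_minus_1:
  "d AND (d - 1) = 0 \<longleftrightarrow> (\<exists>k. d = 2 ^ k)" if "d > 0" for d :: nat
  using that
proof (induction d rule: less_induct)
  case (less d)
  show ?case
  proof (cases "even d")
    case True
    then obtain e where e: "d = 2 * e" by blast
    have pos: "e > 0" using e less.prems by simp
    have "d - 1 = Suc (2 * (e - 1))" using e pos by simp
    then have "d AND (d - 1) = 2 * (e AND (e - 1))"
      using e by (simp add: and_rec [of "2 * e"])
    moreover have "(\<exists>k. d = 2 ^ k) \<longleftrightarrow> (\<exists>k. e = 2 ^ k)"
    proof
      assume "\<exists>k. d = 2 ^ k"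
      then obtain k where "d = 2 ^ k" by blast
      with e show "\<exists>k. e = 2 ^ k" by (cases k) auto
    next
      assume "\<exists>k. e = 2 ^ k"
      with e show "\<exists>k. d = 2 ^ k" by (metis power_Suc)
    qed
    ultimately show ?thesis using less.IH [of e] e pos by simp
  next
    case False
    then obtain e where e: "d = 2 * e + 1" by (rule oddE)
    have "d AND (d - 1) = 2 * e"
      using e by (simp add: and_rec [of "Suc (2 * e)"])
    moreover have "(\<exists>k. d = 2 ^ k) \<longleftrightarrow> e = 0"
    proof
      assume "\<exists>k. d = 2 ^ k"
      then obtain k where "d = 2 ^ k" by blast
      then have "k = 0" using False by (metis dvd_power even_numeral gr0I)
      then show "e = 0" using e \<open>d = 2 ^ k\<close> by simp
    next
      assume "e = 0"
      then have "d = 2 ^ 0" using e by simp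
      then show "\<exists>k. d = 2 ^ k" by blast
    qed
    ultimately show ?thesis by simp
  qed
qed

text \<open>
  Given the outmaps of the two vertices as words, a vertex comparison amounts to a constant number
  of word operations. This is why the machine below may charge one time unit for it.
\<close>

lemma compare_vertices_word_operations:
  assumes "is_orientation n out"
  defines "outw \<equiv> \<lambda>x. word_of (out (vertex_of n x))"
  defines "d \<equiv> \<lambda>x y. (x XOR y) AND (outw x XOR outw y)"
  shows "compare_vertices n out x y =
    (if d x y = 0 then 2 ^ n - 1 else if d x y AND (d x y - 1) = 0 then d x y else 0)"
proof -
  let ?D = "d x y"
  have len: "length (out (vertex_of n z)) = n" for z
    using assms(1) by (simp add: is_orientation_def cube_def vertex_of_def)
  have bit_outw: "bit (outw z) j \<longleftrightarrow> j < n \<and> out (vertex_of n z) ! j" for z j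
    by (simp add: outw_def bit_word_of len)
  have nth: "vertex_of n z ! j \<longleftrightarrow> bit z j" if "j < n" for z j
    using that by (simp add: vertex_of_def)
  have bD: "bit ?D j \<longleftrightarrow> j < n \<and> vertex_of n x ! j \<noteq> vertex_of n y ! j \<and>
      out (vertex_of n x) ! j \<noteq> out (vertex_of n y) ! j" for j
    unfolding d_def bit_and_iff bit_xor_iff bit_outw using nth by blast
  have "certifies n out i (vertex_of n x) (vertex_of n y) \<longleftrightarrow> (\<forall>j. j \<noteq> i \<longrightarrow> \<not> bit ?D j)" for i
    unfolding certifies_def bD by blast
  then have bC: "bit (compare_vertices n out x y) i \<longleftrightarrow> i < n \<and> (\<forall>j. j \<noteq> i \<longrightarrow> \<not> bit ?D j)" for i
    by (auto simp: compare_vertices_def bit_word_of)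
  consider "?D = 0" | k where "?D = 2 ^ k" | "?D > 0" "\<nexists>k. ?D = 2 ^ k"
    by blast
  then show ?thesis
  proof cases
    case 1
    have "compare_vertices n out x y = mask n"
      by (rule bit_eqI) (simp add: bC 1 bit_mask_iff)
    then show ?thesis using 1 by (simp add: mask_eq_exp_minus_1)
  next
    case 2
    have b: "bit ?D j \<longleftrightarrow> j = k" for j
      unfolding 2 by (auto simp: bit_exp_iff)
    then have "k < n" using bD [of k] by simp
    have "compare_vertices n out x y = ?D"
    proof (rule bit_eqI)
      fix i
      have "(\<forall>j. j \<noteq> i \<longrightarrow> \<not> bit ?D j) \<longleftrightarrow> i = k"
        unfolding b by auto
      then show "bit (compare_vertices n out x y) i = bit ?D i"
        unfolding bC b using \<open>k < n\<close> by blast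
    qed
    moreover have "?D AND (?D - 1) = 0" "?D \<noteq> 0"
      using power_of_2_iff_and_minus_1 [of ?D] 2 by auto
    ultimately show ?thesis by simp
  next
    case 3
    have "\<exists>j. j \<noteq> i \<and> bit ?D j" for i
    proof (rule ccontr)
      assume *: "\<not> ?thesis"
      show False
      proof (cases "bit ?D i")
        case True
        then have "bit ?D j \<longleftrightarrow> bit (2 ^ i :: nat) j" for j
          using * by (cases "j = i") (use True in \<open>auto simp: bit_exp_iff\<close>)
        then have "?D = 2 ^ i" by (simp add: bit_eq_iff)
        with 3 show False by blast
      next
        case False
        then have "\<not> bit ?D j" for j
          using * by (cases "j = i") auto
        then have "?D = 0" by (simp add: bit_eq_iff)
        with 3 show False by simp
      qed
    qed
    then have "\<not> bit (compare_vertices n out x y) i" for i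
      unfolding bC by blast
    then have "compare_vertices n out x y = 0"
      by (simp add: bit_eq_iff)
    moreover have "?D AND (?D - 1) \<noteq> 0"
      using power_of_2_iff_and_minus_1 [of ?D] 3 by simp
    ultimately show ?thesis using 3 by simp
  qed
qed


section \<open>A word RAM with vertex comparisons\<close>

text \<open>
  All registers and memory cells hold \<open>b\<close>-bit words and are addressed by natural numbers; every
  computed value is truncated to \<open>b\<close> bits. Each operator, operand, memory access and statement
  costs one time unit. The orientation can be accessed only through \<open>Compare\<close>.
\<close>

datatype binop = Plus | Minus | BitAnd | BitOr | BitXor | ShiftLeft | ShiftRight

datatype expr = Lit nat | Reg nat | Mem expr | Bin binop expr expr

datatype test = Less expr expr | Equal expr expr

datatype com =
    Skip
  | Assign nat expr
  | Write expr expr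
  | Compare nat expr expr
  | Seq com com
  | Cond test com com
  | While test com

text \<open>A state consists of the register contents and the memory contents.\<close>

type_synonym state = "(nat \<Rightarrow> nat) \<times> (nat \<Rightarrow> nat)"

text \<open>Subtraction is that of the natural numbers: it yields \<open>0\<close> instead of a negative result.\<close>

fun binop_val :: "binop \<Rightarrow> nat \<Rightarrow> nat \<Rightarrow> nat" where
  "binop_val Plus x y = x + y"
| "binop_val Minus x y = x - y"
| "binop_val BitAnd x y = x AND y"
| "binop_val BitOr x y = x OR y"
| "binop_val BitXor x y = x XOR y"
| "binop_val ShiftLeft x y = push_bit y x"
| "binop_val ShiftRight x y = drop_bit y x"

fun expr_val :: "nat \<Rightarrow> state \<Rightarrow> expr \<Rightarrow> nat" where
  "expr_val b s (Lit c) = take_bit b c"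
| "expr_val b s (Reg r) = fst s r"
| "expr_val b s (Mem a) = snd s (expr_val b s a)"
| "expr_val b s (Bin f a1 a2) = take_bit b (binop_val f (expr_val b s a1) (expr_val b s a2))"

fun expr_time :: "expr \<Rightarrow> nat" where
  "expr_time (Lit c) = 1"
| "expr_time (Reg r) = 1"
| "expr_time (Mem a) = expr_time a + 1"
| "expr_time (Bin f a1 a2) = expr_time a1 + expr_time a2 + 1"

fun test_val :: "nat \<Rightarrow> state \<Rightarrow> test \<Rightarrow> bool" where
  "test_val b s (Less a1 a2) \<longleftrightarrow> expr_val b s a1 < expr_val b s a2"
| "test_val b s (Equal a1 a2) \<longleftrightarrow> expr_val b s a1 = expr_val b s a2"

fun test_time :: "test \<Rightarrow> nat" where
  "test_time (Less a1 a2) = expr_time a1 + expr_time a2 + 1"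
| "test_time (Equal a1 a2) = expr_time a1 + expr_time a2 + 1"

text \<open>
  \<open>exec b cmp p s t q s'\<close>: with word length \<open>b\<close> and \<open>cmp\<close> answering the vertex comparisons, the
  program \<open>p\<close> started in \<open>s\<close> terminates in \<open>s'\<close> after \<open>t\<close> time units and \<open>q\<close> vertex comparisons.
\<close>

inductive exec ::
    "nat \<Rightarrow> (nat \<Rightarrow> nat \<Rightarrow> nat) \<Rightarrow> com \<Rightarrow> state \<Rightarrow> nat \<Rightarrow> nat \<Rightarrow> state \<Rightarrow> bool"
  for b :: nat and cmp :: "nat \<Rightarrow> nat \<Rightarrow> nat" where
  Skip: "exec b cmp Skip s 1 0 s"
| Assign: "exec b cmp (Assign r a) (R, M) (expr_time a + 1) 0 (R(r := expr_val b (R, M) a), M)"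
| Write: "exec b cmp (Write a1 a2) (R, M) (expr_time a1 + expr_time a2 + 1) 0
    (R, M(expr_val b (R, M) a1 := expr_val b (R, M) a2))"
| Compare: "exec b cmp (Compare r a1 a2) (R, M) (expr_time a1 + expr_time a2 + 1) 1
    (R(r := take_bit b (cmp (expr_val b (R, M) a1) (expr_val b (R, M) a2))), M)"
| Seq: "exec b cmp (Seq c1 c2) s1 (t1 + t2) (q1 + q2) s3"
    if "exec b cmp c1 s1 t1 q1 s2" "exec b cmp c2 s2 t2 q2 s3"
| CondTrue: "exec b cmp (Cond g c1 c2) s (test_time g + t) q s'"
    if "test_val b s g" "exec b cmp c1 s t q s'"
| CondFalse: "exec b cmp (Cond g c1 c2) s (test_time g + t) q s'"
    if "\<not> test_val b s g" "exec b cmp c2 s t q s'"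
| WhileFalse: "exec b cmp (While g c) s (test_time g) 0 s"
    if "\<not> test_val b s g"
| WhileTrue: "exec b cmp (While g c) s1 (test_time g + t1 + t2) (q1 + q2) s3"
    if "test_val b s1 g" "exec b cmp c s1 t1 q1 s2" "exec b cmp (While g c) s2 t2 q2 s3"

inductive_cases exec_SkipE: "exec b cmp Skip s t q s'"
inductive_cases exec_AssignE: "exec b cmp (Assign r a) s t q s'"
inductive_cases exec_WriteE: "exec b cmp (Write a1 a2) s t q s'"
inductive_cases exec_CompareE: "exec b cmp (Compare r a1 a2) s t q s'"
inductive_cases exec_SeqE: "exec b cmp (Seq c1 c2) s t q s'"
inductive_cases exec_CondE: "exec b cmp (Cond g c1 c2) s t q s'"
inductive_cases exec_WhileE: "exec b cmp (While g c) s t q s'"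

lemma exec_deterministic:
  "exec b cmp c s t q s' \<Longrightarrow> exec b cmp c s t' q' s'' \<Longrightarrow> t' = t \<and> q' = q \<and> s'' = s'"
proof (induction arbitrary: t' q' s'' rule: exec.induct)
  case (Skip s)
  then show ?case by (rule exec_SkipE) simp
next
  case (Assign r a R M)
  then show ?case by (rule exec_AssignE) simp
next
  case (Write a1 a2 R M)
  then show ?case by (rule exec_WriteE) simp
next
  case (Compare r a1 a2 R M)
  then show ?case by (rule exec_CompareE) simp
next
  case (Seq c1 s1 t1 q1 s2 c2 t2 q2 s3)
  from Seq.prems show ?case by (rule exec_SeqE) (metis Seq.IH)
next
  case (CondTrue s g c1 t q s' c2)
  from CondTrue.prems show ?case by (rule exec_CondE) (metis CondTrue.hyps(1) CondTrue.IH)+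
next
  case (CondFalse s g c2 t q s' c1)
  from CondFalse.prems show ?case by (rule exec_CondE) (metis CondFalse.hyps(1) CondFalse.IH)+
next
  case (WhileFalse s g c)
  from WhileFalse.prems show ?case by (rule exec_WhileE) (use WhileFalse.hyps in simp_all)
next
  case (WhileTrue s1 g c t1 q1 s2 t2 q2 s3)
  from WhileTrue.prems show ?case by (rule exec_WhileE) (metis WhileTrue.hyps(1) WhileTrue.IH)+
qed

text \<open>The dimension is passed in register \<open>0\<close>.\<close>

definition initial_state :: "nat \<Rightarrow> nat \<Rightarrow> state" where
  "initial_state b n = ((\<lambda>_. 0)(0 := take_bit b n), \<lambda>_. 0)"

text \<open>
  The output is one label for every edge: the label of an \<open>i\<close>-edge is found in memory cell
  \<open>i * 2 ^ n + word_of v\<close>, where \<open>v\<close> is the endpoint of the edge with \<open>v ! i = False\<close>. Two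
  \<open>i\<close>-edges belong to the same part of the output partition iff they have the same label.
\<close>

definition same_label :: "nat \<Rightarrow> state \<Rightarrow> nat \<Rightarrow> (bool list set \<times> bool list set) set" where
  "same_label n s i =
     {(e, e'). e \<in> i_edges n i \<and> e' \<in> i_edges n i \<and>
        (\<exists>v\<in>e. \<exists>w\<in>e'. \<not> v ! i \<and> \<not> w ! i \<and>
           snd s (i * 2 ^ n + word_of v) = snd s (i * 2 ^ n + word_of w))}"

definition output_partition :: "nat \<Rightarrow> state \<Rightarrow> nat \<Rightarrow> bool list set set set" where
  "output_partition n s i = i_edges n i // same_label n s i"

text \<open>
  The program \<open>p\<close> computes all phases of a USO of any dimension, on a word RAM with words of
  \<open>b n\<close> bits, within \<open>time n\<close> time units and with at most \<open>comparisons n\<close> vertex comparisons.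
\<close>

definition computes_all_phases ::
    "com \<Rightarrow> (nat \<Rightarrow> nat) \<Rightarrow> (nat \<Rightarrow> nat) \<Rightarrow> (nat \<Rightarrow> nat) \<Rightarrow> bool" where
  "computes_all_phases p b time comparisons \<longleftrightarrow>
     (\<forall>n out. is_uso n out \<longrightarrow>
        (\<exists>t q s. exec (b n) (compare_vertices n out) p (initial_state (b n) n) t q s \<and>
           t \<le> time n \<and> q \<le> comparisons n \<and>
           (\<forall>i<n. output_partition n s i = phases n out i)))"

end

theory Submission
  imports Defs "HOL-Real_Asymp.Real_Asymp"
begin

text \<open>
  Each of the \<open>3 ^ n\<close> faces needs only one comparison, that of its least with its greatest vertex.
  Indeed, let \<open>S\<close> be a set of \<open>i\<close>-edges that is closed under the certificates found in this way.
  If some pair in direct phase had exactly one of its \<open>i\<close>-edges in \<open>S\<close>, flipping the edges in \<open>S\<close>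
  would create two vertices whose outmaps agree on the face spanned by them. In a face of minimal
  dimension with this property every pair of antipodal vertices has the same outmap on the face. For
  the least and the greatest vertex this means that they certify a pair of edges that \<open>S\<close> separates.

  In a USO two distinct vertices certify at most one coordinate, so at most \<open>3 ^ n\<close> pairs of edges
  have to be merged. With quick-find (relabelling the smaller class) every merge test takes constant
  time and all relabellings together take time \<open>O(n\<^sup>2 * 2 ^ n)\<close>, which is within \<open>O(3 ^ n)\<close>.
\<close>

section \<open>Certificates from the least and greatest vertices of faces\<close>

text \<open>The indistinguishable pair in a minimal face is antipodal, but need not consist of the
  least and the greatest vertex. The obstacle is to carry the agreement from one antipodal pair to
  all of them; a parity argument on outmap patterns does this, using that every non-antipodal pair
  is distinguished. That a comparison yields at most one coordinate comes from the bijectivity of a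
  USO on each face: distinct vertices have different outmap bits at some coordinate where they
  differ, and this coordinate spoils every certificate but its own. Hence the answer is
  \<open>0\<close> or \<open>2 ^ i\<close>. A factor \<open>n\<close> per face would exceed
  \<open>3 ^ n\<close>, so apart from relabelling each face must cost constant time. The next
  superset of \<open>v\<close> after \<open>w\<close> is therefore computed as
  \<open>(w + 1) OR v\<close>, a table turns \<open>2 ^ i\<close> into \<open>i\<close>, and
  relabelling is charged to a potential \<open>\<mu>\<close>.\<close>

text \<open>No two vertices of one \<open>j\<close>-facet are antipodal, so \<open>dist\<close>
  makes the patterns outside \<open>j\<close> injective on it. The facet has as many vertices as
  \<open>D - {j}\<close> has subsets, hence every pattern occurs.\<close>

lemma facet_pattern:
  fixes out :: "'a set \<Rightarrow> 'a set"
  assumes "finite D" "j \<in> D" "Q \<subseteq> D - {j}"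
    and dist: "\<And>X Y. X \<subseteq> D \<Longrightarrow> Y \<subseteq> D \<Longrightarrow> X \<noteq> Y \<Longrightarrow> Y \<noteq> D - X \<Longrightarrow>
      \<exists>k\<in>D. (k \<in> X) \<noteq> (k \<in> Y) \<and> (k \<in> out X) \<noteq> (k \<in> out Y)"
  shows "\<exists>X\<subseteq>D. (j \<in> X \<longleftrightarrow> c) \<and> (\<forall>k\<in>D - {j}. k \<in> out X \<longleftrightarrow> k \<in> Q)"
proof -
  define facet where "facet = {X. X \<subseteq> D \<and> (j \<in> X \<longleftrightarrow> c)}"
  define pat where "pat X = out X \<inter> (D - {j})" for X
  have "inj_on pat facet"
  proof (rule inj_onI, rule ccontr)
    fix X Y assume *: "X \<in> facet" "Y \<in> facet" "pat X = pat Y" "X \<noteq> Y"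
    then have "Y \<noteq> D - X" using assms(2) unfolding facet_def by blast
    then obtain k where k: "k \<in> D" "(k \<in> X) \<noteq> (k \<in> Y)" "(k \<in> out X) \<noteq> (k \<in> out Y)"
      using dist [of X Y] * unfolding facet_def by blast
    then have "k \<noteq> j" using * unfolding facet_def by blast
    then show False using k * unfolding pat_def by blast
  qed
  moreover have "bij_betw (\<lambda>X. if c then insert j X else X) (Pow (D - {j})) facet"
    by (rule bij_betw_byWitness [where f' = "\<lambda>X. X - {j}"])
      (use assms(2) in \<open>auto simp: facet_def\<close>)
  then have "card facet = card (Pow (D - {j}))"
    by (metis bij_betw_same_card)
  ultimately have "card (pat ` facet) = card (Pow (D - {j}))"
    by (simp add: card_image)
  moreover have "pat ` facet \<subseteq> Pow (D - {j})"
    by (auto simp: pat_def)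
  moreover have "finite (Pow (D - {j}))" using assms(1) by simp
  ultimately have "pat ` facet = Pow (D - {j})"
    by (metis card_subset_eq)
  then have "Q \<in> pat ` facet" using assms(3) by simp
  then obtain X where X: "X \<in> facet" "Q = pat X" by (rule imageE)
  have "k \<in> out X \<longleftrightarrow> k \<in> Q" if "k \<in> D - {j}" for k
    using that X(2) by (simp add: pat_def)
  then show ?thesis using X(1) unfolding facet_def by blast
qed

text \<open>
  The patterns attained by an antipodal pair are closed under changing two coordinates, whereas
  changing a single coordinate leads to a pattern that is not attained at all.
\<close>

lemma antipodal_outmaps_agree:
  fixes out :: "'a set \<Rightarrow> 'a set"
  assumes fin: "finite D"
    and dist: "\<And>X Y. X \<subseteq> D \<Longrightarrow> Y \<subseteq> D \<Longrightarrow> X \<noteq> Y \<Longrightarrow> Y \<noteq> D - X \<Longrightarrow>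
      \<exists>k\<in>D. (k \<in> X) \<noteq> (k \<in> Y) \<and> (k \<in> out X) \<noteq> (k \<in> out Y)"
    and "V \<subseteq> D" and V: "\<And>k. k \<in> D \<Longrightarrow> k \<in> out V \<longleftrightarrow> k \<in> out (D - V)"
    and "U \<subseteq> D" "k \<in> D"
  shows "k \<in> out U \<longleftrightarrow> k \<in> out (D - U)"
proof -
  define pat where "pat X = out X \<inter> D" for X
  define paired where "paired P \<longleftrightarrow> (\<exists>X\<subseteq>D. pat X = P \<and> pat (D - X) = P)" for P
  define attained where "attained P \<longleftrightarrow> (\<exists>X\<subseteq>D. pat X = P)" for P
  have pat_dist: "Y = X \<or> Y = D - X" if "X \<subseteq> D" "Y \<subseteq> D" "pat X = pat Y" for X Y
    using dist [of X Y] that unfolding pat_def by blast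
  define flip where "flip j P = (if j \<in> P then P - {j} else insert j P)" for j and P :: "'a set"
  have one: "\<not> attained (flip j P)" if P: "paired P" and jD: "j \<in> D" for j P
  proof
    assume "attained (flip j P)"
    then obtain Z where Z: "Z \<subseteq> D" "pat Z = flip j P" unfolding attained_def by blast
    obtain X where X: "X \<subseteq> D" "pat X = P" "pat (D - X) = P"
      using P unfolding paired_def by metis
    \<comment> \<open>Of the antipodal pair with pattern \<open>P\<close>, the vertex that agrees
      with \<open>Z\<close> at \<open>j\<close> is taken. The patterns of \<open>Y\<close> and
      \<open>Z\<close> differ only at \<open>j\<close>, where the vertices agree, against
      \<open>dist\<close>.\<close>
    define Y where "Y = (if j \<in> X \<longleftrightarrow> j \<in> Z then X else D - X)"
    have Y: "Y \<subseteq> D" "pat Y = P" "j \<in> Y \<longleftrightarrow> j \<in> Z"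
      using X jD by (auto simp: Y_def)
    have ne: "Y \<noteq> Z" using Y Z unfolding flip_def by (auto split: if_splits)
    have "Z \<noteq> D - Y" using Y jD by blast
    then obtain k where k: "k \<in> D" "(k \<in> Y) \<noteq> (k \<in> Z)" "(k \<in> out Y) \<noteq> (k \<in> out Z)"
      using dist [of Y Z] Y Z ne by blast
    then have "k \<noteq> j" using Y by blast
    moreover have "(k \<in> P) \<noteq> (k \<in> flip j P)" using k Y Z unfolding pat_def by blast
    ultimately show False unfolding flip_def by (auto split: if_splits)
  qed
  have two: "paired (flip j (flip k P))" if P: "paired P" "j \<in> D" "k \<in> D" "j \<noteq> k" for j k P
  proof -
    have PD: "P \<subseteq> D" using P(1) unfolding paired_def pat_def by blast
    \<comment> \<open>Each \<open>j\<close>-facet carries a vertex whose pattern is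
      \<open>flip k P\<close> up to coordinate \<open>j\<close>, and \<open>one\<close> excludes
      \<open>flip k P\<close> itself. So the doubly flipped pattern occurs on both facets, and equal
      patterns force these two vertices to be antipodal.\<close>
    have ex: "\<exists>X\<subseteq>D. (j \<in> X \<longleftrightarrow> c) \<and> pat X = flip j (flip k P)" for c
    proof -
      have "flip k P - {j} \<subseteq> D - {j}" using PD P(3) by (auto simp: flip_def split: if_splits)
      then obtain X where X: "X \<subseteq> D" "j \<in> X \<longleftrightarrow> c"
          "\<forall>l\<in>D - {j}. l \<in> out X \<longleftrightarrow> l \<in> flip k P - {j}"
        using facet_pattern [OF fin P(2) _ dist, of "flip k P - {j}" c] by blast
      have "pat X \<noteq> flip k P"
        using one [OF P(1,3)] X(1) unfolding attained_def by blast
      moreover have "pat X - {j} = flip k P - {j}"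
        using X(3) PD P(3) unfolding pat_def flip_def by (auto split: if_splits)
      ultimately have "pat X = flip j (flip k P)"
        unfolding flip_def [of j] by auto
      then show ?thesis using X by blast
    qed
    obtain X where X: "X \<subseteq> D" "j \<in> X" "pat X = flip j (flip k P)" using ex [of True] by blast
    obtain Y where Y: "Y \<subseteq> D" "j \<notin> Y" "pat Y = flip j (flip k P)" using ex [of False] by blast
    have "Y = D - X" using pat_dist [of X Y] X Y by auto
    then show ?thesis using X Y unfolding paired_def by metis
  qed
  define sd where "sd P Q = (P - Q) \<union> (Q - P)" for P Q :: "'a set"
  \<comment> \<open>The parity of the distance from the pattern of \<open>V\<close> decides:
    \<open>two\<close> stays within paired patterns, \<open>one\<close> rules out all odd distances.
    In particular every attained pattern is paired.\<close>
  have even_odd: "if even (card (sd P (pat V))) then paired P else \<not> attained P"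
    if "P \<subseteq> D" for P
    using that
  proof (induction "card (sd P (pat V))" arbitrary: P rule: less_induct)
    case less
    have PV: "pat V \<subseteq> D" by (auto simp: pat_def)
    then have fin_sd: "finite (sd Q (pat V))" if "Q \<subseteq> D" for Q
      using fin that finite_subset unfolding sd_def by (metis Diff_subset finite_Un)
    have dec: "sd (flip j Q) (pat V) = sd Q (pat V) - {j}" if "j \<in> sd Q (pat V)" for j Q
      using that unfolding sd_def flip_def by auto
    have flip2: "flip j (flip j Q) = Q" for j Q unfolding flip_def by auto
    have base: "paired (pat V)"
      using \<open>V \<subseteq> D\<close> V unfolding paired_def pat_def by blast
    consider "sd P (pat V) = {}" | j where "j \<in> sd P (pat V)" by blast
    then show ?case
    proof cases
      case 1
      then have "P = pat V" unfolding sd_def by blast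
      then show ?thesis using base 1 by simp
    next
      case (2 j)
      let ?Q = "flip j P"
      have jD: "j \<in> D" using 2 less.prems PV unfolding sd_def by blast
      have QD: "?Q \<subseteq> D" using less.prems jD unfolding flip_def by auto
      have cQ: "card (sd P (pat V)) = Suc (card (sd ?Q (pat V)))"
        unfolding dec [OF 2] by (rule card.remove [OF fin_sd [OF less.prems] 2])
      have IHQ: "if even (card (sd ?Q (pat V))) then paired ?Q else \<not> attained ?Q"
        using less.hyps [of ?Q] cQ QD by simp
      show ?thesis
      proof (cases "even (card (sd P (pat V)))")
        case False
        then have "paired ?Q" using IHQ cQ by simp
        then have "\<not> attained P" using one [of ?Q j] jD flip2 by simp
        then show ?thesis using False by simp
      next
        case True
        then have "card (sd ?Q (pat V)) \<noteq> 0" using cQ by (metis even_Suc even_zero)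
        then obtain k where k: "k \<in> sd ?Q (pat V)" by fastforce
        let ?Q' = "flip k ?Q"
        have kj: "k \<noteq> j" using k dec [OF 2] by blast
        have kD: "k \<in> D" using k QD PV unfolding sd_def by blast
        have QD': "?Q' \<subseteq> D" using QD kD unfolding flip_def by auto
        have c': "card (sd ?Q (pat V)) = Suc (card (sd ?Q' (pat V)))"
          unfolding dec [OF k] by (rule card.remove [OF fin_sd [OF QD] k])
        have "paired ?Q'" using less.hyps [of ?Q'] cQ c' QD' True by simp
        then have "paired (flip j (flip k ?Q'))" using two jD kD kj by blast
        then show ?thesis using True flip2 by simp
      qed
    qed
  qed
  have "attained (pat U)" using \<open>U \<subseteq> D\<close> unfolding attained_def by blast
  then have "paired (pat U)" using even_odd [of "pat U"] by (auto simp: pat_def split: if_splits)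
  then obtain X where X: "X \<subseteq> D" "pat X = pat U" "pat (D - X) = pat U"
    unfolding paired_def by blast
  have "U = X \<or> U = D - X" using pat_dist [of X U] X \<open>U \<subseteq> D\<close> by simp
  then have "pat (D - U) = pat U"
    using X by (metis double_diff order_refl)
  then show ?thesis using \<open>k \<in> D\<close> unfolding pat_def by blast
qed

section \<open>Bijectivity of unique sink outmaps on faces\<close>

text \<open>The face has least vertex \<open>B\<close> and directions \<open>D\<close>. In the step,
  each \<open>j\<close>-facet has exactly one vertex with pattern \<open>P\<close> outside
  \<open>j\<close>. By induction exactly one vertex of the whole face has pattern \<open>P\<close>;
  it is one of these two, so the other is the only one with pattern
  \<open>insert j P\<close>.\<close>

lemma unique_pattern:
  fixes out :: "'a set \<Rightarrow> 'a set"
  assumes sink: "\<And>B D. B \<subseteq> K \<Longrightarrow> D \<subseteq> K - B \<Longrightarrow> \<exists>!X. X \<subseteq> D \<and> out (B \<union> X) \<inter> D = {}"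
    and "finite K" "B \<subseteq> K" "D \<subseteq> K - B" "P \<subseteq> D"
  shows "\<exists>!X. X \<subseteq> D \<and> out (B \<union> X) \<inter> D = P"
proof -
  have "finite P" using assms by (meson finite_Diff finite_subset)
  then show ?thesis using assms(3-)
  proof (induction P arbitrary: B D rule: finite_induct)
    case empty
    then show ?case using sink by simp
  next
    case (insert j P)
    let ?D = "D - {j}"
    have j: "j \<in> D" "j \<notin> B" "j \<in> K" "P \<subseteq> ?D" using insert.hyps insert.prems by auto
    have lo: "\<exists>!X. X \<subseteq> ?D \<and> out (B \<union> X) \<inter> ?D = P"
      using insert.prems j by (intro insert.IH) auto
    have "\<exists>!X. X \<subseteq> ?D \<and> out (insert j B \<union> X) \<inter> ?D = P"
      using insert.prems j by (intro insert.IH) auto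
    then have hi: "\<exists>!X. X \<subseteq> ?D \<and> out (B \<union> insert j X) \<inter> ?D = P" by simp
    obtain X0 where X0: "X0 \<subseteq> ?D" "out (B \<union> X0) \<inter> ?D = P"
      and X0u: "\<And>X. X \<subseteq> ?D \<Longrightarrow> out (B \<union> X) \<inter> ?D = P \<Longrightarrow> X = X0" using lo by metis
    obtain X1 where X1: "X1 \<subseteq> ?D" "out (B \<union> insert j X1) \<inter> ?D = P"
      and X1u: "\<And>X. X \<subseteq> ?D \<Longrightarrow> out (B \<union> insert j X) \<inter> ?D = P \<Longrightarrow> X = X1" using hi by metis
    have cases: "X = X0 \<or> X = insert j X1" if "X \<subseteq> D" "out (B \<union> X) \<inter> ?D = P" for X
    proof (cases "j \<in> X")
      case True
      then have "insert j (X - {j}) = X" by blast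
      then show ?thesis using X1u [of "X - {j}"] that by auto
    next
      case False
      then show ?thesis using X0u [of X] that by blast
    qed
    have "\<exists>!X. X \<subseteq> D \<and> out (B \<union> X) \<inter> D = P"
      using insert.prems j by (intro insert.IH) auto
    then obtain Z where Z: "Z \<subseteq> D" "out (B \<union> Z) \<inter> D = P"
      and Zu: "\<And>X. X \<subseteq> D \<Longrightarrow> out (B \<union> X) \<inter> D = P \<Longrightarrow> X = Z" by metis
    have "out (B \<union> Z) \<inter> ?D = P"
      using Z(2) insert.hyps(2) by (simp flip: Int_Diff)
    then have Zc: "Z = X0 \<or> Z = insert j X1" using cases [of Z] Z(1) by blast
    have mem: "X \<subseteq> D \<and> out (B \<union> X) \<inter> D = insert j P \<longleftrightarrow>
        (X = X0 \<or> X = insert j X1) \<and> X \<noteq> Z" for X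
    proof
      assume *: "X \<subseteq> D \<and> out (B \<union> X) \<inter> D = insert j P"
      then have "out (B \<union> X) \<inter> ?D = P"
        using insert.hyps(2) by (simp flip: Int_Diff)
      moreover have "insert j P \<noteq> P" using insert.hyps(2) by blast
      ultimately show "(X = X0 \<or> X = insert j X1) \<and> X \<noteq> Z"
        using cases [of X] * Z(2) by metis
    next
      assume *: "(X = X0 \<or> X = insert j X1) \<and> X \<noteq> Z"
      then have X: "X \<subseteq> D" "out (B \<union> X) \<inter> ?D = P" using X0 X1 j by auto
      then have "out (B \<union> X) \<inter> D \<noteq> P" using Zu [of X] * by metis
      moreover have "out (B \<union> X) \<inter> D =
          (if j \<in> out (B \<union> X) then insert j (out (B \<union> X) \<inter> ?D) else out (B \<union> X) \<inter> ?D)"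
        using j by auto
      ultimately show "X \<subseteq> D \<and> out (B \<union> X) \<inter> D = insert j P" using X by metis
    qed
    have "X0 \<noteq> insert j X1" using X0 by blast
    then show ?case unfolding mem using Zc by metis
  qed
qed

text \<open>Both vertices lie in the face above \<open>V \<inter> W\<close> spanned by their
  symmetric difference. If nothing distinguished them they would share a pattern there, against
  \<open>unique_pattern\<close>.\<close>

lemma outmaps_distinguish:
  fixes out :: "'a set \<Rightarrow> 'a set"
  assumes sink: "\<And>B D. B \<subseteq> K \<Longrightarrow> D \<subseteq> K - B \<Longrightarrow> \<exists>!X. X \<subseteq> D \<and> out (B \<union> X) \<inter> D = {}"
    and K: "finite K" and V: "V \<subseteq> K" and W: "W \<subseteq> K" and "V \<noteq> W"
  shows "\<exists>k\<in>K. (k \<in> V) \<noteq> (k \<in> W) \<and> (k \<in> out V) \<noteq> (k \<in> out W)"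
proof (rule ccontr)
  assume no: "\<not> ?thesis"
  define D where "D = (V - W) \<union> (W - V)"
  have "\<exists>!X. X \<subseteq> D \<and> out (V \<inter> W \<union> X) \<inter> D = out V \<inter> D"
    by (rule unique_pattern [OF sink K]) (use V W in \<open>auto simp: D_def\<close>)
  moreover have "V - W \<subseteq> D \<and> out (V \<inter> W \<union> (V - W)) \<inter> D = out V \<inter> D"
  proof -
    have "V \<inter> W \<union> (V - W) = V" by blast
    then show ?thesis by (auto simp: D_def)
  qed
  moreover have "W - V \<subseteq> D \<and> out (V \<inter> W \<union> (W - V)) \<inter> D = out V \<inter> D"
  proof -
    have "V \<inter> W \<union> (W - V) = W" by blast
    moreover have "out W \<inter> D = out V \<inter> D" using no V W unfolding D_def by blast
    ultimately show ?thesis by (auto simp: D_def)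
  qed
  ultimately have "V - W = W - V" by metis
  then show False using \<open>V \<noteq> W\<close> by blast
qed

text \<open>
  If \<open>S\<close> separated the \<open>i\<close>-edges at \<open>V\<close> and \<open>W\<close>, then flipping the \<open>i\<close>-edges in \<open>S\<close> would make the
  outmaps of \<open>V\<close> and \<open>W\<close> indistinguishable. In a face of minimal dimension where this happens,
  all antipodal pairs are indistinguishable; for the least and the greatest vertex this contradicts
  the closure property of \<open>S\<close>.
\<close>

lemma min_max_certificates_suffice:
  fixes out :: "'a set \<Rightarrow> 'a set"
  assumes K: "finite K"
    and dist: "\<And>V W. V \<subseteq> K \<Longrightarrow> W \<subseteq> K \<Longrightarrow> V \<noteq> W \<Longrightarrow>
      \<exists>k\<in>K. (k \<in> V) \<noteq> (k \<in> W) \<and> (k \<in> out V) \<noteq> (k \<in> out W)"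
    and S: "\<And>B T. B \<subseteq> T \<Longrightarrow> T \<subseteq> K \<Longrightarrow> i \<in> T - B \<Longrightarrow>
      (\<forall>k\<in>T - B - {i}. k \<in> out B \<longleftrightarrow> k \<in> out T) \<Longrightarrow> S B \<longleftrightarrow> S (T - {i})"
    and V: "V \<subseteq> K" and W: "W \<subseteq> K"
    and cert: "\<And>k. k \<in> K \<Longrightarrow> k \<noteq> i \<Longrightarrow> (k \<in> V) \<noteq> (k \<in> W) \<Longrightarrow> k \<in> out V \<longleftrightarrow> k \<in> out W"
  shows "S (V - {i}) \<longleftrightarrow> S (W - {i})"
proof (rule ccontr)
  assume sep: "S (V - {i}) \<noteq> S (W - {i})"
  \<comment> \<open>\<open>S\<close> is read at the lower end \<open>X - {i}\<close>, so both ends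
    of an \<open>i\<close>-edge are flipped together.\<close>
  define flipped where "flipped X = {k. (k \<in> out X) \<noteq> (k = i \<and> S (X - {i}))}" for X
  define bad where "bad p \<longleftrightarrow> (\<exists>X Y. p = (X, Y) \<and> X \<subseteq> K \<and> Y \<subseteq> K \<and> X \<noteq> Y \<and>
    (\<forall>k\<in>K. (k \<in> X) \<noteq> (k \<in> Y) \<longrightarrow> (k \<in> flipped X \<longleftrightarrow> k \<in> flipped Y)))" for p
  define sd where "sd X Y = (X - Y) \<union> (Y - X)" for X Y :: "'a set"
  have bad_iff: "bad (X, Y) \<longleftrightarrow> X \<subseteq> K \<and> Y \<subseteq> K \<and> X \<noteq> Y \<and>
    (\<forall>k\<in>K. (k \<in> X) \<noteq> (k \<in> Y) \<longrightarrow> (k \<in> flipped X \<longleftrightarrow> k \<in> flipped Y))" for X Y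
    unfolding bad_def by simp
  have ne: "V \<noteq> W" using sep by blast
  obtain k where k: "k \<in> K" "(k \<in> V) \<noteq> (k \<in> W)" "(k \<in> out V) \<noteq> (k \<in> out W)"
    using dist [OF V W ne] by blast
  then have "k = i" using cert by blast
  \<comment> \<open>Only \<open>i\<close> distinguished \<open>V\<close> from \<open>W\<close>, and
    reversing exactly one of their \<open>i\<close>-edges removes this difference.\<close>
  have "bad (V, W)"
    unfolding bad_def
  proof (intro exI conjI ballI impI)
    fix l assume l: "l \<in> K" "(l \<in> V) \<noteq> (l \<in> W)"
    show "l \<in> flipped V \<longleftrightarrow> l \<in> flipped W"
    proof (cases "l = i")
      case True
      then show ?thesis using k \<open>k = i\<close> sep unfolding flipped_def by blast
    next
      case False
      then show ?thesis using cert l unfolding flipped_def by blast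
    qed
  qed (use V W ne in simp_all)
  then obtain p where p: "bad p" and
      min: "\<And>q. bad q \<Longrightarrow> card (sd (fst p) (snd p)) \<le> card (sd (fst q) (snd q))"
    using exists_least_iff [of "\<lambda>m. \<exists>p. bad p \<and> card (sd (fst p) (snd p)) = m"]
    by (metis linorder_not_less)
  obtain X Y where XY: "p = (X, Y)" "X \<subseteq> K" "Y \<subseteq> K" "X \<noteq> Y"
      "\<And>k. k \<in> K \<Longrightarrow> (k \<in> X) \<noteq> (k \<in> Y) \<Longrightarrow> k \<in> flipped X \<longleftrightarrow> k \<in> flipped Y"
    using p unfolding bad_def by blast
  define D where "D = sd X Y"
  define B where "B = X \<inter> Y"
  have D: "D \<subseteq> K" "D \<inter> B = {}" "finite D" "D \<noteq> {}" "B \<subseteq> K"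
    using XY K unfolding D_def B_def sd_def by (auto intro: finite_subset)
  have BX: "B \<union> (X - Y) = X" "B \<union> (D - (X - Y)) = Y"
    unfolding D_def B_def sd_def by auto
  \<comment> \<open>By minimality every non-antipodal pair in the face is distinguished;
    \<open>X - Y\<close> and its complement form the agreeing pair from which the parity argument
    starts.\<close>
  have agree: "k \<in> flipped (B \<union> U) \<longleftrightarrow> k \<in> flipped (B \<union> (D - U))"
    if "U \<subseteq> D" "k \<in> D" for U k
  proof (rule antipodal_outmaps_agree [where out = "\<lambda>U. flipped (B \<union> U)" and V = "X - Y"])
    fix U1 U2 assume *: "U1 \<subseteq> D" "U2 \<subseteq> D" "U1 \<noteq> U2" "U2 \<noteq> D - U1"
    have sub: "sd (B \<union> U1) (B \<union> U2) = sd U1 U2" using * D unfolding sd_def by blast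
    have "sd U1 U2 \<subset> D" using * unfolding sd_def by blast
    then have "card (sd (B \<union> U1) (B \<union> U2)) < card D"
      unfolding sub using D by (metis psubset_card_mono)
    then have "\<not> bad (B \<union> U1, B \<union> U2)" using min [of "(B \<union> U1, B \<union> U2)"] XY D_def by auto
    moreover have "B \<union> U1 \<noteq> B \<union> U2" "B \<union> U1 \<subseteq> K" "B \<union> U2 \<subseteq> K" using * D by blast+
    ultimately obtain k where k: "k \<in> K" "(k \<in> B \<union> U1) \<noteq> (k \<in> B \<union> U2)"
        "(k \<in> flipped (B \<union> U1)) \<noteq> (k \<in> flipped (B \<union> U2))"
      unfolding bad_iff by blast
    then have "k \<in> D" "(k \<in> U1) \<noteq> (k \<in> U2)" using * by auto
    then show "\<exists>k\<in>D. (k \<in> U1) \<noteq> (k \<in> U2) \<and>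
        (k \<in> flipped (B \<union> U1)) \<noteq> (k \<in> flipped (B \<union> U2))"
      using k by blast
  next
    show "X - Y \<subseteq> D" unfolding D_def sd_def by blast
  next
    fix k assume "k \<in> D"
    then show "k \<in> flipped (B \<union> (X - Y)) \<longleftrightarrow> k \<in> flipped (B \<union> (D - (X - Y)))"
      unfolding BX using XY(5) [of k] D(1) unfolding D_def sd_def by blast
  qed (use D that in auto)
  define T where "T = B \<union> D"
  have T: "B \<subseteq> T" "T \<subseteq> K" "T - B = D" "B \<noteq> T" using D unfolding T_def by auto
  have BT: "k \<in> flipped B \<longleftrightarrow> k \<in> flipped T" if "k \<in> D" for k
    using agree [of "{}" k] that unfolding T_def by simp
  \<comment> \<open>Before the reversal \<open>B\<close> and \<open>T\<close> are distinguished,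
    afterwards they are not. This is possible only at \<open>i\<close>, and only if \<open>S\<close>
    separates their \<open>i\<close>-edges.\<close>
  obtain l where l: "l \<in> K" "(l \<in> B) \<noteq> (l \<in> T)" "(l \<in> out B) \<noteq> (l \<in> out T)"
    using dist [of B T] T D by blast
  have "l \<in> D" using l T by blast
  then have "l = i" "S (B - {i}) \<noteq> S (T - {i})"
    using BT [of l] l unfolding flipped_def by auto
  moreover have "B - {i} = B" using \<open>l = i\<close> \<open>l \<in> D\<close> D by blast
  moreover have "\<forall>k\<in>T - B - {i}. k \<in> out B \<longleftrightarrow> k \<in> out T"
  proof
    fix k assume "k \<in> T - B - {i}"
    then have "k \<in> D" "k \<noteq> i" using T(3) by auto
    then show "k \<in> out B \<longleftrightarrow> k \<in> out T" using BT [of k] unfolding flipped_def by simp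
  qed
  moreover have "i \<in> T - B" using \<open>l = i\<close> \<open>l \<in> D\<close> T(3) by simp
  ultimately show False using S [of B T] T(1,2) by simp
qed

section \<open>Execution with accumulated running time\<close>

text \<open>The parameter \<open>\<tau>\<close> is the time already spent, so postconditions and
  loop invariants speak of total time. The number of comparisons is dropped here and recovered from
  \<open>comparisons_le_time\<close>.\<close>

definition wp :: "nat \<Rightarrow> (nat \<Rightarrow> nat \<Rightarrow> nat) \<Rightarrow> com \<Rightarrow> (nat \<Rightarrow> state \<Rightarrow> bool) \<Rightarrow> nat \<Rightarrow> state \<Rightarrow> bool"
  where "wp b cmp c Q \<tau> s \<longleftrightarrow> (\<exists>t q s'. exec b cmp c s t q s' \<and> Q (\<tau> + t) s')"

lemma wp_Skip [simp]: "wp b cmp Skip Q \<tau> s \<longleftrightarrow> Q (\<tau> + 1) s"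
  unfolding wp_def by (metis exec.Skip exec_SkipE)

lemma wp_Assign [simp]:
  "wp b cmp (Assign r a) Q \<tau> (R, M) \<longleftrightarrow>
     Q (\<tau> + expr_time a + 1) (R(r := expr_val b (R, M) a), M)"
  unfolding wp_def by (fastforce intro: exec.Assign elim: exec_AssignE simp: add.assoc)

lemma wp_Write [simp]:
  "wp b cmp (Write a1 a2) Q \<tau> (R, M) \<longleftrightarrow>
     Q (\<tau> + expr_time a1 + expr_time a2 + 1)
       (R, M(expr_val b (R, M) a1 := expr_val b (R, M) a2))"
  unfolding wp_def by (fastforce intro: exec.Write elim: exec_WriteE simp: add.assoc)

lemma wp_Compare [simp]:
  "wp b cmp (Compare r a1 a2) Q \<tau> (R, M) \<longleftrightarrow>
     Q (\<tau> + expr_time a1 + expr_time a2 + 1)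
       (R(r := take_bit b (cmp (expr_val b (R, M) a1) (expr_val b (R, M) a2))), M)"
  unfolding wp_def by (fastforce intro: exec.Compare elim: exec_CompareE simp: add.assoc)

lemma wp_Seq [simp]: "wp b cmp (Seq c1 c2) Q \<tau> s \<longleftrightarrow> wp b cmp c1 (wp b cmp c2 Q) \<tau> s"
proof
  assume "wp b cmp (Seq c1 c2) Q \<tau> s"
  then show "wp b cmp c1 (wp b cmp c2 Q) \<tau> s"
    unfolding wp_def by (auto elim!: exec_SeqE simp: add.assoc) blast
next
  assume "wp b cmp c1 (wp b cmp c2 Q) \<tau> s"
  then show "wp b cmp (Seq c1 c2) Q \<tau> s"
    unfolding wp_def by (metis exec.Seq add.assoc)
qed

lemma wp_Cond [simp]:
  "wp b cmp (Cond g c1 c2) Q \<tau> s \<longleftrightarrow>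
     (if test_val b s g then wp b cmp c1 Q (\<tau> + test_time g) s
      else wp b cmp c2 Q (\<tau> + test_time g) s)"
  unfolding wp_def by (auto elim!: exec_CondE simp: add.assoc) (metis exec.CondTrue exec.CondFalse)+

text \<open>Every iteration takes time, so a bound on the accumulated time implies termination.\<close>

lemma wp_While:
  assumes "I \<tau> s"
    and step: "\<And>\<tau> s. I \<tau> s \<Longrightarrow> test_val b s g \<Longrightarrow> wp b cmp c I (\<tau> + test_time g) s"
    and bound: "\<And>\<tau> s. I \<tau> s \<Longrightarrow> \<tau> \<le> B"
    and exit: "\<And>\<tau> s. I \<tau> s \<Longrightarrow> \<not> test_val b s g \<Longrightarrow> Q (\<tau> + test_time g) s"
  shows "wp b cmp (While g c) Q \<tau> s"
  using assms(1)
proof (induction "B - \<tau>" arbitrary: \<tau> s rule: less_induct)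
  case less
  show ?case
  proof (cases "test_val b s g")
    case False
    then show ?thesis unfolding wp_def using exit [OF less.prems] exec.WhileFalse by blast
  next
    case True
    then obtain t q s' where t: "exec b cmp c s t q s'" "I (\<tau> + test_time g + t) s'"
      using step [OF less.prems] unfolding wp_def by blast
    have "test_time g > 0" by (cases g) auto
    then have "B - (\<tau> + test_time g + t) < B - \<tau>" using bound [OF t(2)] by linarith
    then have "wp b cmp (While g c) Q (\<tau> + test_time g + t) s'" using less.hyps t(2) by blast
    then obtain t' q' s'' where "exec b cmp (While g c) s' t' q' s''"
        "Q (\<tau> + test_time g + t + t') s''"
      unfolding wp_def by blast
    then show ?thesis
      unfolding wp_def using exec.WhileTrue [OF True t(1)] by (metis add.assoc)
  qed
qed

text \<open>Each \<open>Compare\<close> costs at least one time unit, so the time bound also serves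
  as the comparison bound.\<close>

lemma comparisons_le_time: "exec b cmp c s t q s' \<Longrightarrow> q \<le> t"
  by (induction rule: exec.induct) auto

section \<open>Enumerating the faces\<close>

text \<open>Read as bit sets, \<open>(w + 1) OR v\<close> is the superset of \<open>v\<close> that
  follows \<open>w\<close> in numerical order. The induction strips the lowest bit.\<close>

lemma next_superset_least:
  fixes v w u :: nat
  assumes "v AND w = v" "v AND u = v" "w < u"
  shows "(w + 1) OR v \<le> u"
  using assms
proof (induction w arbitrary: v u rule: less_induct)
  case (less w)
  have div: "(x AND y) div 2 = (x div 2) AND (y div 2)" for x y :: nat
    by (simp add: drop_bit_Suc [of 0, simplified, symmetric])
  have par: "odd v \<Longrightarrow> odd w \<and> odd u" 
    using less.prems(1,2) by (metis even_and_iff)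
  have v2: "(v div 2) AND (w div 2) = v div 2" "(v div 2) AND (u div 2) = v div 2"
    using less.prems(1,2) div by metis+
  show ?case
  proof (cases "even w")
    case True
    then have "even v" using par by blast
    have "(w + 1) OR v = w + 1"
    proof (rule bit_eqI)
      fix j
      show "bit ((w + 1) OR v) j = bit (w + 1) j"
      proof (cases j)
        case 0 then show ?thesis using True \<open>even v\<close> by (simp add: bit_0 even_or_iff)
      next
        case (Suc m)
        have "bit (v div 2) m \<Longrightarrow> bit (w div 2) m" using v2 by (metis bit_and_iff)
        moreover have "(w + 1) div 2 = w div 2" using True by simp
        ultimately have "bit v j \<Longrightarrow> bit (w + 1) j" unfolding Suc bit_Suc by simp
        then show ?thesis unfolding bit_or_iff by blast
      qed
    qed
    then show ?thesis using less.prems by simp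
  next
    case False
    have "w div 2 < w" using False by (cases w) auto
    moreover have "w div 2 < u div 2" using less.prems(3) False by (auto elim!: oddE)
    ultimately have IH: "(w div 2 + 1) OR (v div 2) \<le> u div 2"
      using less.IH [of "w div 2" "v div 2" "u div 2"] v2 by blast
    have orr: "(x OR y) div 2 = (x div 2) OR (y div 2)" for x y :: nat
      by (simp add: drop_bit_Suc [of 0, simplified, symmetric])
    \<comment> \<open>For odd \<open>w\<close> the increment carries: the upper bits follow the same
      rule on the halves, and the lowest bit becomes that of \<open>v\<close>.\<close>
    have "(w + 1) div 2 = w div 2 + 1" "even (w + 1)" using False by (auto elim!: oddE)
    then have "((w + 1) OR v) div 2 = (w div 2 + 1) OR (v div 2)" "((w + 1) OR v) mod 2 = v mod 2"
      using orr by (auto simp: mod2_eq_if even_or_iff)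
    then have "(w + 1) OR v = 2 * ((w div 2 + 1) OR (v div 2)) + v mod 2"
      by (metis mult_div_mod_eq)
    also have "\<dots> \<le> 2 * (u div 2) + u mod 2"
    proof -
      have "v mod 2 \<le> u mod 2" using par by (auto simp: mod2_eq_if)
      then show ?thesis using IH by linarith
    qed
    finally show ?thesis by simp
  qed
qed

lemma next_superset: "v AND ((w + 1) OR v) = (v :: nat)" "w < (w + 1) OR (v :: nat)"
proof -
  show "v AND ((w + 1) OR v) = v" by (rule bit_eqI) (auto simp: bit_simps)
  have "w + 1 \<le> (w + 1) OR v"
    unfolding or_nat_def by (simp add: nat_le_iff or_greater_eq le_nat_iff)
  then show "w < (w + 1) OR v" by linarith
qed

text \<open>A face is encoded by its least vertex \<open>v\<close> and greatest vertex
  \<open>w\<close>; \<open>v AND w = v\<close> is inclusion of bit sets.\<close>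

definition sub_pairs :: "nat \<Rightarrow> (nat \<times> nat) set" where
  "sub_pairs n = {(v, w). v AND w = v \<and> v < 2 ^ n \<and> w < 2 ^ n}"

lemma finite_sub_pairs: "finite (sub_pairs n)"
  by (rule finite_subset [of _ "{..<2 ^ n} \<times> {..<2 ^ n}"]) (auto simp: sub_pairs_def)

lemma card_sub_pairs: "card (sub_pairs n) \<le> 3 ^ n"
proof (induction n)
  case 0
  have "sub_pairs 0 = {(0, 0)}" by (auto simp: sub_pairs_def)
  then show ?case by simp
next
  case (Suc n)
  let ?f = "\<lambda>((v, w), (a, c)). (2 * v + a, 2 * w + c) :: nat \<times> nat"
  let ?A = "{(0, 0), (0, 1), (1, 1)} :: (nat \<times> nat) set"
  have "p \<in> ?f ` (sub_pairs n \<times> ?A)" if "p \<in> sub_pairs (Suc n)" for p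
  proof -
    obtain v w where p: "p = (v, w)" by force
    have *: "v AND w = v" "v < 2 * 2 ^ n" "w < 2 * 2 ^ n" using that p by (auto simp: sub_pairs_def)
    have "(v div 2) AND (w div 2) = (v AND w) div 2"
      by (simp add: drop_bit_Suc [of 0, simplified, symmetric])
    then have "(v div 2, w div 2) \<in> sub_pairs n" using * by (simp add: sub_pairs_def less_mult_imp_div_less mult.commute)
    moreover have "odd v \<longrightarrow> odd w" using *(1) by (metis even_and_iff)
    then have "(v mod 2, w mod 2) \<in> ?A" by (auto simp: mod2_eq_if)
    moreover have "p = ?f ((v div 2, w div 2), (v mod 2, w mod 2))" using p by simp
    ultimately show ?thesis by (metis (no_types, lifting) SigmaI image_eqI)
  qed
  then have "card (sub_pairs (Suc n)) \<le> card (?f ` (sub_pairs n \<times> ?A))"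
    by (intro card_mono finite_imageI) (auto simp: finite_sub_pairs)
  also have "\<dots> \<le> card (sub_pairs n \<times> ?A)"
    by (rule card_image_le) (simp add: finite_sub_pairs)
  also have "\<dots> = card (sub_pairs n) * 3" by (simp add: card_cartesian_product)
  finally show ?case using Suc by simp
qed

lemma and_le_nat: "x AND y \<le> (y :: nat)"
proof -
  have "int (x AND y) \<le> int y" by (simp add: of_nat_and_eq AND_upper2)
  then show ?thesis by linarith
qed

section \<open>Quick-find with linked lists\<close>

fun chain :: "(nat \<Rightarrow> nat) \<Rightarrow> nat \<Rightarrow> nat list \<Rightarrow> bool" where
  "chain nxt p [] \<longleftrightarrow> True"
| "chain nxt p (x # xs) \<longleftrightarrow> p = x \<and> chain nxt (nxt x) xs"

lemma chain_cong: "chain nxt p xs \<Longrightarrow> (\<And>x. x \<in> set xs \<Longrightarrow> nxt' x = nxt x) \<Longrightarrow> chain nxt' p xs"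
  by (induction nxt p xs rule: chain.induct) auto

text \<open>
  Cell \<open>x\<close> holds the label of \<open>x\<close>. The members of the class labelled \<open>l\<close> form a linked list whose
  first element is in cell \<open>K + l\<close> and whose length is in cell \<open>3 * K + l\<close>; the successor of \<open>x\<close> is
  in cell \<open>2 * K + x\<close>. There is no end marker: the length tells where a list ends.
\<close>

definition quick_find :: "nat \<Rightarrow> nat \<Rightarrow> (nat \<Rightarrow> nat) \<Rightarrow> bool" where
  "quick_find K N M \<longleftrightarrow> (\<forall>x<N. M x < N) \<and>
     (\<forall>l<N. \<exists>xs. chain (\<lambda>x. M (2 * K + x)) (M (K + l)) xs \<and> distinct xs \<and>
        set xs = {x. x < N \<and> M x = l} \<and> M (3 * K + l) = length xs)"

lemma quick_find_size:
  assumes "quick_find K N M" "l < N"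
  shows "M (3 * K + l) = card {x. x < N \<and> M x = l}"
proof -
  obtain xs where "distinct xs" "set xs = {x. x < N \<and> M x = l}" "M (3 * K + l) = length xs"
    using assms unfolding quick_find_def by blast
  then show ?thesis using distinct_card [of xs] by simp
qed

lemma quick_find_size_le: "quick_find K N M \<Longrightarrow> l < N \<Longrightarrow> M (3 * K + l) \<le> N"
  using card_mono [of "{..<N}" "{x. x < N \<and> M x = l}"] quick_find_size [of K N M l]
  by (simp add: subset_iff)

lemma quick_find_head:
  assumes "quick_find K N M" "l < N" "M (3 * K + l) > 0"
  shows "M (K + l) < N" "M (M (K + l)) = l"
proof -
  obtain xs where xs: "chain (\<lambda>x. M (2 * K + x)) (M (K + l)) xs"
      "set xs = {x. x < N \<and> M x = l}" "M (3 * K + l) = length xs"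
    using assms unfolding quick_find_def by blast
  then obtain y ys where "xs = y # ys" using assms(3) by (cases xs) auto
  then have "M (K + l) \<in> set xs" using xs(1) by simp
  then show "M (K + l) < N" "M (M (K + l)) = l" unfolding xs(2) by auto
qed

text \<open>For \<open>x = M (K + a)\<close> this pops the head of list \<open>a\<close> and pushes
  it onto list \<open>c\<close>. All right-hand sides read the old memory; the program reads after
  earlier writes, with the same result since the cells are distinct.\<close>

definition move :: "nat \<Rightarrow> nat \<Rightarrow> nat \<Rightarrow> nat \<Rightarrow> (nat \<Rightarrow> nat) \<Rightarrow> (nat \<Rightarrow> nat)" where
  "move K a c x M = M(K + a := M (2 * K + x), 2 * K + x := M (K + c), K + c := x, x := c,
     3 * K + a := M (3 * K + a) - 1, 3 * K + c := M (3 * K + c) + 1)"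

text \<open>Lists with different labels are disjoint, so redirecting the successor of
  \<open>x\<close> affects no list other than those of \<open>a\<close> and
  \<open>c\<close>.\<close>

lemma quick_find_move:
  assumes qf: "quick_find K N M" and NK: "N \<le> K" and ac: "a < N" "c < N" "a \<noteq> c"
    and pos: "M (3 * K + a) > 0" and x: "x = M (K + a)"
  defines "M' \<equiv> move K a c x M"
  shows "quick_find K N M'"
    and "\<And>y. y < N \<Longrightarrow> M' y = (if y = x then c else M y)"
    and "M' (3 * K + a) = M (3 * K + a) - 1"
    and "\<And>y. y \<ge> 4 * K \<Longrightarrow> M' y = M y"
proof -
  have xN: "x < N" "M x = a" using quick_find_head [OF qf ac(1) pos] x by auto
  show lab: "M' y = (if y = x then c else M y)" if "y < N" for y
    using that xN NK ac by (simp add: M'_def move_def)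
  show size_a: "M' (3 * K + a) = M (3 * K + a) - 1"
    using NK ac by (simp add: M'_def move_def)
  have size_c: "M' (3 * K + c) = M (3 * K + c) + 1"
    by (simp add: M'_def move_def)
  have size: "M' (3 * K + l) = M (3 * K + l)" if "l < N" "l \<noteq> a" "l \<noteq> c" for l
    using that xN NK ac by (simp add: M'_def move_def)
  have head: "M' (K + a) = M (2 * K + x)" "M' (K + c) = x"
    "\<And>l. l < N \<Longrightarrow> l \<noteq> a \<Longrightarrow> l \<noteq> c \<Longrightarrow> M' (K + l) = M (K + l)"
    using xN NK ac by (simp_all add: M'_def move_def)
  have nxt: "M' (2 * K + x) = M (K + c)"
    "\<And>y. y < N \<Longrightarrow> y \<noteq> x \<Longrightarrow> M' (2 * K + y) = M (2 * K + y)"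
    using xN NK ac by (simp_all add: M'_def move_def)
  show "M' y = M y" if "y \<ge> 4 * K" for y
    using that xN NK ac by (simp add: M'_def move_def)
  show "quick_find K N M'"
    unfolding quick_find_def
  proof (intro conjI allI impI)
    fix y assume "y < N"
    then show "M' y < N" using lab [of y] qf ac unfolding quick_find_def by auto
  next
    fix l assume l: "l < N"
    obtain xs where xs: "chain (\<lambda>x. M (2 * K + x)) (M (K + l)) xs" "distinct xs"
        "set xs = {x. x < N \<and> M x = l}" "M (3 * K + l) = length xs"
      using qf l unfolding quick_find_def by blast
    consider "l = a" | "l = c" | "l \<noteq> a" "l \<noteq> c" by blast
    then show "\<exists>xs. chain (\<lambda>x. M' (2 * K + x)) (M' (K + l)) xs \<and> distinct xs \<and>
        set xs = {x. x < N \<and> M' x = l} \<and> M' (3 * K + l) = length xs"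
    proof cases
      case 1
      obtain ys where ys: "xs = x # ys" using xs 1 pos x by (cases xs) auto
      have ys_set: "set ys = {y. y < N \<and> M' y = l}"
      proof -
        have "set ys = set xs - {x}" using ys xs(2) by auto
        also have "\<dots> = {y. y < N \<and> M y = a \<and> y \<noteq> x}" using xs(3) 1 by blast
        also have "\<dots> = {y. y < N \<and> M' y = l}"
          unfolding 1 using lab ac(3) by (intro Collect_cong) auto
        finally show ?thesis .
      qed
      have "chain (\<lambda>x. M' (2 * K + x)) (M' (K + l)) ys"
      proof (rule chain_cong)
        show "chain (\<lambda>x. M (2 * K + x)) (M' (K + l)) ys" using xs(1) ys head 1 by simp
        show "M' (2 * K + y) = M (2 * K + y)" if "y \<in> set ys" for y
          using that xs ys nxt by auto
      qed
      then show ?thesis using ys_set xs ys size_a 1 by (intro exI [of _ ys]) auto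
    next
      case 2
      have "x \<notin> set xs" using xs(3) xN 2 ac by simp
      then have "M' (2 * K + y) = M (2 * K + y)" if "y \<in> set xs" for y
        using that xs(3) nxt(2) by auto
      then have "chain (\<lambda>x. M' (2 * K + x)) (M (K + l)) xs" by (rule chain_cong [OF xs(1)])
      then have "chain (\<lambda>x. M' (2 * K + x)) (M' (K + l)) (x # xs)"
        using head nxt(1) 2 by simp
      moreover have "set (x # xs) = {y. y < N \<and> M' y = l}"
        using xs(3) lab xN 2 by auto
      ultimately show ?thesis
        using \<open>x \<notin> set xs\<close> xs size_c 2 by (intro exI [of _ "x # xs"]) auto
    next
      case 3
      have "x \<notin> set xs" using xs(3) xN 3 by simp
      then have "M' (2 * K + y) = M (2 * K + y)" if "y \<in> set xs" for y
        using that xs(3) nxt(2) by auto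
      then have "chain (\<lambda>x. M' (2 * K + x)) (M (K + l)) xs" by (rule chain_cong [OF xs(1)])
      then have "chain (\<lambda>x. M' (2 * K + x)) (M' (K + l)) xs"
        using head(3) l 3 by simp
      moreover have "set xs = {y. y < N \<and> M' y = l}"
        using xs(3) lab xN 3 by auto
      ultimately show ?thesis
        using xs size l 3 by (intro exI [of _ xs]) auto
    qed
  qed
qed

text \<open>
  \<open>\<mu>\<close> counts the moved elements. An element is moved only into a class that is at least as large as
  its own, so each move doubles the size of its class.
\<close>

definition moves :: "nat \<Rightarrow> (nat \<Rightarrow> nat) \<Rightarrow> nat \<Rightarrow> bool" where
  "moves N M \<mu> \<longleftrightarrow>
     (\<exists>m. (\<forall>x<N. 2 ^ m x \<le> card {y. y < N \<and> M y = M x}) \<and> \<mu> = (\<Sum>x<N. m x))"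

text \<open>Each exponent \<open>m x\<close> is at most \<open>k\<close>, because no class has more
  than \<open>N\<close> elements.\<close>

lemma moves_bound:
  assumes "moves N M \<mu>" "N \<le> 2 ^ k"
  shows "\<mu> \<le> N * k"
proof -
  obtain m where m: "\<And>x. x < N \<Longrightarrow> 2 ^ m x \<le> card {y. y < N \<and> M y = M x}"
      "\<mu> = (\<Sum>x<N. m x)"
    using assms(1) unfolding moves_def by blast
  have "m x \<le> k" if "x < N" for x
  proof -
    have "card {y. y < N \<and> M y = M x} \<le> card {..<N}"
      by (intro card_mono) auto
    then have "card {y. y < N \<and> M y = M x} \<le> N" by simp
    then have "2 ^ m x \<le> (2 :: nat) ^ k" using m(1) [OF that] assms(2) by linarith
    then show ?thesis by simp
  qed
  then have "\<mu> \<le> (\<Sum>x<N. k)" unfolding m(2) by (intro sum_mono) simp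
  then show ?thesis by simp
qed

text \<open>Elements of the smaller class end up in a class at least twice as large, which lets
  their exponents grow by one; no other class shrinks, apart from the vanishing
  \<open>a\<close>.\<close>

lemma moves_merge:
  assumes "moves N M \<mu>" and ac: "a \<noteq> c"
    and le: "card {y. y < N \<and> M y = a} \<le> card {y. y < N \<and> M y = c}"
    and M': "\<And>y. y < N \<Longrightarrow> M' y = (if M y = a then c else M y)"
  shows "moves N M' (\<mu> + card {y. y < N \<and> M y = a})"
proof -
  obtain m where m: "\<And>x. x < N \<Longrightarrow> 2 ^ m x \<le> card {y. y < N \<and> M y = M x}"
      "\<mu> = (\<Sum>x<N. m x)"
    using assms(1) unfolding moves_def by blast
  define m' where "m' x = m x + (if M x = a then 1 else 0)" for x
  have "2 ^ m' x \<le> card {y. y < N \<and> M' y = M' x}" if x: "x < N" for x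
  proof (cases "M x = a \<or> M x = c")
    case True
    have "M' y = M' x \<longleftrightarrow> M y = a \<or> M y = c" if "y < N" for y
      using True M' [OF x] M' [OF that] ac by auto
    then have "{y. y < N \<and> M' y = M' x} = {y. y < N \<and> M y = a} \<union> {y. y < N \<and> M y = c}"
      by auto
    then have "card {y. y < N \<and> M' y = M' x} =
        card {y. y < N \<and> M y = a} + card {y. y < N \<and> M y = c}"
      using ac by (simp add: card_Un_disjoint disjoint_iff)
    then show ?thesis using m(1) [OF x] True le by (auto simp: m'_def)
  next
    case False
    have "M' y = M' x \<longleftrightarrow> M y = M x" if "y < N" for y
      using False M' [OF x] M' [OF that] by auto
    then have "{y. y < N \<and> M' y = M' x} = {y. y < N \<and> M y = M x}"
      by auto
    then show ?thesis using m(1) [OF x] False by (simp add: m'_def)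
  qed
  moreover have "(\<Sum>x<N. m' x) = \<mu> + card {y. y < N \<and> M y = a}"
  proof -
    have "(\<Sum>x<N. if M x = a then 1 else 0) = card {y. y < N \<and> M y = a}"
      by (simp add: sum.If_cases lessThan_def Collect_conj_eq)
    then show ?thesis by (simp add: m'_def sum.distrib m(2))
  qed
  ultimately show ?thesis unfolding moves_def by metis
qed

section \<open>The program\<close>

text \<open>
  Registers 1 to 5 hold \<open>2 ^ n\<close> and the addresses of the arrays: with \<open>K = 2 ^ (2 * n)\<close>, these are
  \<open>K\<close>, \<open>2 * K\<close>, \<open>3 * K\<close> and \<open>4 * K\<close>. The last array maps \<open>2 ^ i\<close> to \<open>i\<close>.
\<close>

definition plus_cell :: "nat \<Rightarrow> nat \<Rightarrow> expr" where
  "plus_cell r r' = Bin Plus (Reg r) (Reg r')"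

definition move_loop :: com where
  "move_loop =
    While (Less (Lit 0) (Mem (plus_cell 4 9)))
     (Seq (Assign 11 (Mem (plus_cell 2 9)))
     (Seq (Write (plus_cell 2 9) (Mem (plus_cell 3 11)))
     (Seq (Write (plus_cell 3 11) (Mem (plus_cell 2 10)))
     (Seq (Write (plus_cell 2 10) (Reg 11))
     (Seq (Write (Reg 11) (Reg 10))
     (Seq (Write (plus_cell 4 9) (Bin Minus (Mem (plus_cell 4 9)) (Lit 1)))
          (Write (plus_cell 4 10) (Bin Plus (Mem (plus_cell 4 10)) (Lit 1)))))))))"

text \<open>The swap puts the label of the smaller class into register 9, the source of
  \<open>move_loop\<close>.\<close>

definition union_com :: com where
  "union_com =
    Cond (Equal (Reg 9) (Reg 10)) Skip
     (Seq (Cond (Less (Mem (plus_cell 4 10)) (Mem (plus_cell 4 9)))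
            (Seq (Assign 11 (Reg 9)) (Seq (Assign 9 (Reg 10)) (Assign 10 (Reg 11))))
            Skip)
          move_loop)"

definition next_com :: com where
  "next_com = Assign 7 (Bin BitOr (Bin Plus (Reg 7) (Lit 1)) (Reg 6))"

text \<open>A nonzero answer \<open>2 ^ i\<close> is decoded by the table at register 5; the shift
  gives the offset \<open>i * 2 ^ n\<close>. The vertex in register 6 is already the lower end of
  its \<open>i\<close>-edge, and subtracting the answer from register 7 gives the other lower
  end.\<close>

definition compare_com :: com where
  "compare_com =
    Seq (Compare 8 (Reg 6) (Reg 7))
     (Cond (Equal (Reg 8) (Lit 0)) Skip
       (Seq (Assign 12 (Bin ShiftLeft (Mem (plus_cell 5 8)) (Reg 0)))
       (Seq (Assign 9 (Mem (plus_cell 12 6)))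
       (Seq (Assign 10 (Mem (Bin Plus (Reg 12) (Bin Minus (Reg 7) (Reg 8)))))
            union_com))))"

text \<open>Running \<open>next_com\<close> before the inner loop skips the pair
  \<open>v = w\<close>, for which a comparison would return the full mask instead of at most one
  bit.\<close>

definition faces_loop :: com where
  "faces_loop =
    While (Less (Reg 6) (Reg 1))
     (Seq (Assign 7 (Reg 6))
     (Seq next_com
     (Seq (While (Less (Reg 7) (Reg 1)) (Seq compare_com next_com))
          (Assign 6 (Bin Plus (Reg 6) (Lit 1))))))"

definition log_loop :: com where
  "log_loop =
    While (Less (Reg 12) (Reg 0))
     (Seq (Write (Bin Plus (Reg 5) (Bin ShiftLeft (Lit 1) (Reg 12))) (Reg 12))
          (Assign 12 (Bin Plus (Reg 12) (Lit 1))))"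

text \<open>Successor cells get no initial value, since the length 1 already ends each list.\<close>

definition singletons_loop :: com where
  "singletons_loop =
    While (Less (Reg 12) (Reg 11))
     (Seq (Write (Reg 12) (Reg 12))
     (Seq (Write (plus_cell 2 12) (Reg 12))
     (Seq (Write (plus_cell 4 12) (Lit 1))
          (Assign 12 (Bin Plus (Reg 12) (Lit 1))))))"

definition constants_com :: com where
  "constants_com =
    Seq (Assign 1 (Bin ShiftLeft (Lit 1) (Reg 0)))
    (Seq (Assign 2 (Bin ShiftLeft (Reg 1) (Reg 0)))
    (Seq (Assign 3 (plus_cell 2 2))
    (Seq (Assign 4 (plus_cell 3 2))
         (Assign 5 (plus_cell 4 2)))))"

text \<open>Shifting register 0 by itself gives \<open>n * 2 ^ n\<close>, the number of label cells.
  Half of them, with bit \<open>i\<close> set in block \<open>i\<close>, represent no edge and stay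
  singletons.\<close>

definition phases_com :: com where
  "phases_com =
    Seq constants_com
    (Seq log_loop
    (Seq (Assign 12 (Lit 0))
    (Seq (Assign 11 (Bin ShiftLeft (Reg 0) (Reg 0)))
    (Seq singletons_loop
         faces_loop))))"

definition face_pairs :: "nat \<Rightarrow> (nat \<times> nat) set" where
  "face_pairs n = {p \<in> sub_pairs n. fst p \<noteq> snd p}"

definition links :: "nat \<Rightarrow> (nat \<Rightarrow> nat \<Rightarrow> nat) \<Rightarrow> nat \<times> nat \<Rightarrow> (nat \<times> nat) set" where
  "links n cmp p =
     {(i * 2 ^ n + fst p, i * 2 ^ n + (snd p - 2 ^ i)) | i. i < n \<and> cmp (fst p) (snd p) = 2 ^ i}"

text \<open>
  Equal labels are connected by links. Connectedness is expressed by the predicates \<open>f\<close> that are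
  constant along links; this makes its preservation under a merge a purely propositional matter.
\<close>

definition sound :: "nat \<Rightarrow> (nat \<Rightarrow> nat \<Rightarrow> nat) \<Rightarrow> (nat \<Rightarrow> nat) \<Rightarrow> bool" where
  "sound n cmp M \<longleftrightarrow> (\<forall>f :: nat \<Rightarrow> bool. (\<forall>p\<in>face_pairs n. \<forall>(x, y)\<in>links n cmp p. f x = f y) \<longrightarrow>
     (\<forall>x<n * 2 ^ n. \<forall>y<n * 2 ^ n. M x = M y \<longrightarrow> f x = f y))"

text \<open>The charges are 20 per table entry, 30 per singleton, 100 per face, 40 per least vertex
  and 60 per relabelling. An element is relabelled at most \<open>2 * n\<close> times because
  \<open>n * 2 ^ n \<le> 2 ^ (2 * n)\<close>.\<close>

definition time_bound :: "nat \<Rightarrow> nat" where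
  "time_bound n = 100 + 20 * n + 30 * (n * 2 ^ n) + 100 * 3 ^ n + 40 * 2 ^ n +
     60 * ((n * 2 ^ n) * (2 * n))"

lemma key_less: "i < n \<Longrightarrow> v < 2 ^ n \<Longrightarrow> i * 2 ^ n + v < n * 2 ^ n" for i v n :: nat
proof -
  assume "i < n" "v < 2 ^ n"
  then have "i * 2 ^ n + v < Suc i * 2 ^ n" by simp
  also have "\<dots> \<le> n * 2 ^ n" using \<open>i < n\<close> by (intro mult_right_mono) auto
  finally show ?thesis .
qed

section \<open>Analysis of the program with an abstract comparison oracle\<close>

context
  fixes n b :: nat and cmp :: "nat \<Rightarrow> nat \<Rightarrow> nat" and K N :: nat
  assumes b: "8 * 2 ^ (2 * n) \<le> (2 :: nat) ^ b"
    and cmp: "\<And>v w. v < 2 ^ n \<Longrightarrow> w < 2 ^ n \<Longrightarrow> v AND w = v \<Longrightarrow> v \<noteq> w \<Longrightarrow>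
      cmp v w = 0 \<or> (\<exists>i<n. cmp v w = 2 ^ i \<and> bit w i \<and> \<not> bit v i)"
  defines "K \<equiv> 2 ^ (2 * n)" and "N \<equiv> n * 2 ^ n"
begin

text \<open>The highest cells used are \<open>4 * K + 2 ^ i\<close>, so the factor 8 keeps all
  addresses and values safe from truncation.\<close>

lemma word: "x < 8 * K \<Longrightarrow> take_bit b x = x"
  using b unfolding K_def by (intro take_bit_nat_eq_self) linarith

lemma K_pos: "0 < K" unfolding K_def by simp

lemma n_less: "n < 2 ^ n" by simp

lemma pow_le_K: "2 ^ n \<le> K" unfolding K_def by (intro power_increasing) auto

lemma n_less_K: "n < K"
  by (rule less_le_trans [OF n_less pow_le_K])

lemma N_le: "N \<le> K"
proof -
  have "n * 2 ^ n \<le> 2 ^ n * (2 ^ n :: nat)" using n_less by (intro mult_right_mono) auto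
  then show ?thesis unfolding N_def K_def by (simp add: power_add mult_2)
qed

lemma b_pos [simp]: "0 < b"
proof (rule ccontr)
  assume "\<not> 0 < b"
  then have "take_bit b 1 = (0 :: nat)" by simp
  then show False using word [of 1] K_pos by simp
qed

definition addresses :: "(nat \<Rightarrow> nat) \<Rightarrow> bool" where
  "addresses R \<longleftrightarrow> R 0 = n \<and> R 1 = 2 ^ n \<and> R 2 = K \<and> R 3 = 2 * K \<and> R 4 = 3 * K \<and> R 5 = 4 * K"

lemma addresses_upd [simp]: "5 < r \<Longrightarrow> addresses (R(r := x)) \<longleftrightarrow> addresses R"
  by (simp add: addresses_def)

lemma wp_move_loop:
  assumes R: "addresses R" "R 9 = a" "R 10 = c" and ac: "a < N" "c < N" "a \<noteq> c"
    and qf: "quick_find K N M"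
    and Q: "\<And>\<tau>' R' M'. (\<And>r. r \<noteq> 11 \<Longrightarrow> R' r = R r) \<Longrightarrow> quick_find K N M' \<Longrightarrow>
      (\<And>y. y < N \<Longrightarrow> M' y = (if M y = a then c else M y)) \<Longrightarrow>
      (\<And>y. y \<ge> 4 * K \<Longrightarrow> M' y = M y) \<Longrightarrow>
      \<tau>' \<le> \<tau> + 60 * card {y. y < N \<and> M y = a} + 10 \<Longrightarrow> Q \<tau>' (R', M')"
  shows "wp b cmp move_loop Q \<tau> (R, M)"
proof -
  \<comment> \<open>Every element still in the list of \<open>a\<close> holds a credit of 60, which
    covers one pass with its test.\<close>
  define I where "I \<tau>' s \<longleftrightarrow> (\<forall>r. r \<noteq> 11 \<longrightarrow> fst s r = R r) \<and> quick_find K N (snd s) \<and>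
     (\<forall>y<N. M y \<noteq> a \<longrightarrow> snd s y = M y) \<and> (\<forall>y<N. M y = a \<longrightarrow> snd s y = a \<or> snd s y = c) \<and>
     (\<forall>y\<ge>4 * K. snd s y = M y) \<and>
     \<tau>' + 60 * snd s (3 * K + a) \<le> \<tau> + 60 * M (3 * K + a)" for \<tau>' and s :: state
  show ?thesis
    unfolding move_loop_def
  proof (rule wp_While [where I = I and B = "\<tau> + 60 * M (3 * K + a)"])
    show "I \<tau> (R, M)" using qf by (auto simp: I_def)
  next
    fix \<tau>' s assume "I \<tau>' s"
    then show "\<tau>' \<le> \<tau> + 60 * M (3 * K + a)" by (auto simp: I_def)
  next
    fix \<tau>' s
    assume I: "I \<tau>' s" and g: "test_val b s (Less (Lit 0) (Mem (plus_cell 4 9)))"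
    obtain R' M' where s: "s = (R', M')" by force
    have R': "R' 2 = K" "R' 3 = 2 * K" "R' 4 = 3 * K" "R' 9 = a" "R' 10 = c"
      using I R by (auto simp: I_def s addresses_def)
    have w3: "take_bit b (3 * K + l) = 3 * K + l" "take_bit b (2 * K + l) = 2 * K + l"
        "take_bit b (K + l) = K + l" if "l < N" for l
      using that N_le by (auto intro!: word)
    have qf': "quick_find K N M'" using I by (simp add: I_def s)
    have pos: "M' (3 * K + a) > 0"
      using g ac R' by (simp add: s plus_cell_def w3)
    define x where "x = M' (K + a)"
    have x: "x < N" "M' x = a" using quick_find_head [OF qf' ac(1) pos] by (auto simp: x_def)
    have sizes: "M' (3 * K + a) \<le> N" "M' (3 * K + c) \<le> N"
      using quick_find_size_le [OF qf'] ac by auto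
    have ws: "take_bit b (M' (3 * K + a) - Suc 0) = M' (3 * K + a) - Suc 0"
      "take_bit b (Suc (M' (3 * K + c))) = Suc (M' (3 * K + c))"
      using sizes N_le K_pos by (auto intro!: word)
    note mv = quick_find_move [OF qf' N_le ac pos x_def]
    have "I (\<tau>' + 60) (R'(11 := x), move K a c x M')"
      using I mv(1,3,4) pos x unfolding I_def s by (auto simp: mv(2))
    \<comment> \<open>The invariant is downward closed in time, so the exact cost of a pass is
      irrelevant as long as it is at most 60. Later loops use the same device.\<close>
    then have "\<And>\<tau>''. \<tau>'' \<le> \<tau>' + 60 \<Longrightarrow> I \<tau>'' (R'(11 := x), move K a c x M')"
      by (auto simp: I_def)
    then show "wp b cmp
         (Seq (Assign 11 (Mem (plus_cell 2 9)))
         (Seq (Write (plus_cell 2 9) (Mem (plus_cell 3 11)))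
         (Seq (Write (plus_cell 3 11) (Mem (plus_cell 2 10)))
         (Seq (Write (plus_cell 2 10) (Reg 11))
         (Seq (Write (Reg 11) (Reg 10))
         (Seq (Write (plus_cell 4 9) (Bin Minus (Mem (plus_cell 4 9)) (Lit 1)))
              (Write (plus_cell 4 10) (Bin Plus (Mem (plus_cell 4 10)) (Lit 1)))))))))
         I (\<tau>' + test_time (Less (Lit 0) (Mem (plus_cell 4 9)))) s"
      using ac x N_le
      by (simp add: s plus_cell_def R' w3 ws move_def flip: x_def)
  next
    fix \<tau>' s
    assume I: "I \<tau>' s" and g: "\<not> test_val b s (Less (Lit 0) (Mem (plus_cell 4 9)))"
    obtain R' M' where s: "s = (R', M')" by force
    have R': "R' 4 = 3 * K" "R' 9 = a" using I R by (auto simp: I_def s addresses_def)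
    have "take_bit b (3 * K + a) = 3 * K + a" using ac N_le by (auto intro!: word)
    then have "M' (3 * K + a) = 0" using g R' by (simp add: s plus_cell_def)
    moreover have qf': "quick_find K N M'" using I by (simp add: I_def s)
    ultimately have "card {y. y < N \<and> M' y = a} = 0" using quick_find_size ac by metis
    then have none: "M' y \<noteq> a" if "y < N" for y using that by auto
    show "Q (\<tau>' + test_time (Less (Lit 0) (Mem (plus_cell 4 9)))) s"
      unfolding s
    proof (rule Q [OF _ qf'])
      show "M' y = (if M y = a then c else M y)" if "y < N" for y
        using I none [OF that] that unfolding I_def s by auto
      show "\<tau>' + test_time (Less (Lit 0) (Mem (plus_cell 4 9))) \<le>
          \<tau> + 60 * card {y. y < N \<and> M y = a} + 10"
        using I quick_find_size [OF qf ac(1)] unfolding I_def s by (simp add: plus_cell_def)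
    qed (use I in \<open>auto simp: I_def s\<close>)
  qed
qed

text \<open>Time is amortised: relabelling is paid by the growth from \<open>\<mu>\<close> to
  \<open>\<mu>'\<close>, the rest by 50. The new partition is described symmetrically in
  \<open>a\<close> and \<open>c\<close> because the swap hides which label survives.\<close>

lemma wp_union_com:
  assumes R: "addresses R" "R 9 = a" "R 10 = c" and ac: "a < N" "c < N"
    and qf: "quick_find K N M" and \<mu>: "moves N M \<mu>"
    and Q: "\<And>\<tau>' R' M' \<mu>'. (\<And>r. r \<noteq> 9 \<Longrightarrow> r \<noteq> 10 \<Longrightarrow> r \<noteq> 11 \<Longrightarrow> R' r = R r) \<Longrightarrow>
      quick_find K N M' \<Longrightarrow> moves N M' \<mu>' \<Longrightarrow>
      (\<And>y z. y < N \<Longrightarrow> z < N \<Longrightarrow>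
        M' y = M' z \<longleftrightarrow> M y = M z \<or> M y \<in> {a, c} \<and> M z \<in> {a, c}) \<Longrightarrow>
      (\<And>y. y \<ge> 4 * K \<Longrightarrow> M' y = M y) \<Longrightarrow>
      \<tau>' + 60 * \<mu> \<le> \<tau> + 60 * \<mu>' + 50 \<Longrightarrow> Q \<tau>' (R', M')"
  shows "wp b cmp union_com Q \<tau> (R, M)"
proof (cases "a = c")
  case True
  have "Q (Suc (Suc (Suc (Suc \<tau>)))) (R, M)" by (rule Q [OF _ qf \<mu>]) (use True in auto)
  then show ?thesis using R True by (simp add: union_com_def)
next
  case False
  have merge: "wp b cmp move_loop Q \<tau>' (R', M)"
    if R': "addresses R'" "\<And>r. r \<noteq> 9 \<Longrightarrow> r \<noteq> 10 \<Longrightarrow> r \<noteq> 11 \<Longrightarrow> R' r = R r" and "\<tau>' \<le> \<tau> + 40"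
      and ac': "{R' 9, R' 10} = {a, c}" "M (3 * K + R' 9) \<le> M (3 * K + R' 10)" for \<tau>' R'
  proof (rule wp_move_loop [OF R'(1) refl refl _ _ _ qf])
    show lt: "R' 9 < N" "R' 10 < N" and ne: "R' 9 \<noteq> R' 10"
      using ac' ac False by (auto simp: doubleton_eq_iff)
    fix \<tau>'' R'' M'
    assume *: "\<And>r. r \<noteq> 11 \<Longrightarrow> R'' r = R' r" "quick_find K N M'"
      "\<And>y. y < N \<Longrightarrow> M' y = (if M y = R' 9 then R' 10 else M y)"
      "\<And>y. y \<ge> 4 * K \<Longrightarrow> M' y = M y"
      "\<tau>'' \<le> \<tau>' + 60 * card {y. y < N \<and> M y = R' 9} + 10"
    show "Q \<tau>'' (R'', M')"
    proof (rule Q [OF _ *(2) moves_merge [OF \<mu> ne _ *(3)]])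
      show "card {y. y < N \<and> M y = R' 9} \<le> card {y. y < N \<and> M y = R' 10}"
        using ac'(2) quick_find_size [OF qf] lt by simp
      show "M' y = M' z \<longleftrightarrow> M y = M z \<or> M y \<in> {a, c} \<and> M z \<in> {a, c}"
        if "y < N" "z < N" for y z
        using *(3) that ne by (auto simp flip: ac'(1))
    qed (use * R'(2) \<open>\<tau>' \<le> \<tau> + 40\<close> in auto)
  qed
  have w: "take_bit b (3 * K + l) = 3 * K + l" if "l < N" for l
    using that N_le by (auto intro!: word)
  have "R 4 = 3 * K" using R(1) by (simp add: addresses_def)
  then show ?thesis
    unfolding union_com_def using R ac False
    by (auto simp: plus_cell_def w intro!: merge)
qed


lemma sound_iff:
  "sound n cmp M \<longleftrightarrow> (\<forall>f :: nat \<Rightarrow> bool. (\<forall>p\<in>face_pairs n. \<forall>(x, y)\<in>links n cmp p. f x = f y) \<longrightarrow>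
     (\<forall>x<N. \<forall>y<N. M x = M y \<longrightarrow> f x = f y))"
  by (simp add: sound_def N_def)

text \<open>\<open>V\<close> collects the faces processed so far. Completeness concerns only their
  links, whereas soundness refers to the links of all faces and so is a fixed condition
  throughout.\<close>

definition labelling :: "(nat \<times> nat) set \<Rightarrow> (nat \<Rightarrow> nat) \<Rightarrow> bool" where
  "labelling V M \<longleftrightarrow> V \<subseteq> face_pairs n \<and> quick_find K N M \<and> (\<forall>i<n. M (4 * K + 2 ^ i) = i) \<and>
     (\<forall>p\<in>V. \<forall>(x, y)\<in>links n cmp p. M x = M y) \<and> sound n cmp M"

lemma pow_less: "i < n \<Longrightarrow> 2 ^ i < (2 :: nat) ^ n"
  by simp

lemma face_pairsD:
  assumes "(v, w) \<in> face_pairs n"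
  shows "v < 2 ^ n" "w < 2 ^ n" "v AND w = v" "v \<noteq> w"
  using assms by (auto simp: face_pairs_def sub_pairs_def)

lemma wp_compare_com:
  assumes R: "addresses R" "R 6 = v" "R 7 = w" and vw: "(v, w) \<in> face_pairs n"
    and lab: "labelling V M" and \<mu>: "moves N M \<mu>"
    and Q: "\<And>\<tau>' R' M' \<mu>'. addresses R' \<Longrightarrow> R' 6 = v \<Longrightarrow> R' 7 = w \<Longrightarrow>
      labelling (insert (v, w) V) M' \<Longrightarrow> moves N M' \<mu>' \<Longrightarrow>
      \<tau>' + 60 * \<mu> \<le> \<tau> + 60 * \<mu>' + 80 \<Longrightarrow> Q \<tau>' (R', M')"
  shows "wp b cmp compare_com Q \<tau> (R, M)"
proof -
  note vw' = face_pairsD [OF vw]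
  consider "cmp v w = 0" | i where "i < n" "cmp v w = 2 ^ i" "bit w i" "\<not> bit v i"
    using cmp [OF vw'] by metis
  then show ?thesis
  proof cases
    case 1
    then have "links n cmp (v, w) = {}" by (simp add: links_def)
    then have "labelling (insert (v, w) V) M" using lab vw by (simp add: labelling_def)
    then have "\<And>\<tau>'. \<tau>' \<le> \<tau> + 80 \<Longrightarrow> Q \<tau>' (R(8 := 0), M)"
      using R \<mu> by (intro Q) auto
    then show ?thesis using R 1 by (simp add: compare_com_def)
  next
    case (2 i)
    have "2 ^ i \<le> w" using 2(3) by (metis bit_iff_odd div_less even_zero not_le)
    define x1 where "x1 = i * 2 ^ n + v"
    define x2 where "x2 = i * 2 ^ n + (w - 2 ^ i)"
    have x: "x1 < N" "x2 < N"
      using vw' 2 unfolding x1_def x2_def by (auto intro!: key_less [where n = n, folded N_def])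
    have link: "links n cmp (v, w) = {(x1, x2)}" using 2 by (auto simp: links_def x1_def x2_def)
    have logi: "M (4 * K + 2 ^ i) = i" and qf: "quick_find K N M"
      using lab 2 by (auto simp: labelling_def)
    have less: "i * 2 ^ n < N" "(2 :: nat) ^ i < K"
      using key_less [of i n 0, folded N_def] less_le_trans [OF pow_less [OF 2(1)] pow_le_K] 2(1) by auto
    have "(2 :: nat) ^ i < 2 ^ b" using less b unfolding K_def by linarith
    then have words: "i < b" "take_bit b (4 * K + 2 ^ i) = 4 * K + 2 ^ i"
        "take_bit b (i * 2 ^ n) = i * 2 ^ n" "take_bit b x1 = x1" "take_bit b x2 = x2"
        "take_bit b (w - 2 ^ i) = w - 2 ^ i"
      using less x N_le K_pos vw'(2) pow_le_K by (auto intro!: word simp del: take_bit_of_exp)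
    let ?R = "R(8 := 2 ^ i, 12 := i * 2 ^ n, 9 := M x1, 10 := M x2)"
    have "wp b cmp union_com Q \<tau>' (?R, M)" if \<tau>': "\<tau>' \<le> \<tau> + 30" for \<tau>'
    proof (rule wp_union_com [OF _ _ _ _ _ qf \<mu>, where a = "M x1" and c = "M x2"])
      show "M x1 < N" "M x2 < N" using qf x by (auto simp: quick_find_def)
      fix \<tau>'' R' M' \<mu>'
      assume *: "\<And>r. r \<noteq> 9 \<Longrightarrow> r \<noteq> 10 \<Longrightarrow> r \<noteq> 11 \<Longrightarrow> R' r = ?R r"
        "quick_find K N M'" "moves N M' \<mu>'"
        "\<And>y z. y < N \<Longrightarrow> z < N \<Longrightarrow> M' y = M' z \<longleftrightarrow>
          M y = M z \<or> M y \<in> {M x1, M x2} \<and> M z \<in> {M x1, M x2}"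
        "\<And>y. y \<ge> 4 * K \<Longrightarrow> M' y = M y" "\<tau>'' + 60 * \<mu> \<le> \<tau>' + 60 * \<mu>' + 50"
      have links_less: "x < N \<and> y < N" if "(x, y) \<in> links n cmp p" "p \<in> face_pairs n" for x y p
        using that face_pairsD [of "fst p" "snd p"] by (auto simp: links_def intro!: key_less [where n = n, folded N_def])
      \<comment> \<open>The current link gives \<open>f x1 = f x2\<close>, so \<open>f\<close> is
        constant on the union of the two merged classes.\<close>
      have snd': "sound n cmp M'"
        unfolding sound_iff
      proof (intro allI impI)
        fix f :: "nat \<Rightarrow> bool" and y z
        assume f: "\<forall>p\<in>face_pairs n. \<forall>(x, y)\<in>links n cmp p. f x = f y" and yz: "y < N" "z < N" "M' y = M' z"
        have old: "f y = f z" if "M y = M z" "y < N" "z < N" for y z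
          using lab f that unfolding labelling_def sound_iff by blast
        have "f x1 = f x2" using f vw link by fastforce
        moreover have "M y = M z \<or> M y \<in> {M x1, M x2} \<and> M z \<in> {M x1, M x2}"
          using *(4) yz by blast
        ultimately show "f y = f z"
          using old [of y z] old [of y x1] old [of y x2] old [of z x1] old [of z x2] x yz by auto
      qed
      have "M' y = M' z" if p: "p \<in> insert (v, w) V" and yz: "(y, z) \<in> links n cmp p" for p y z
      proof (cases "p = (v, w)")
        case True
        then show ?thesis using yz link *(4) [of x1 x2] x by auto
      next
        case False
        then have "M y = M z" "p \<in> face_pairs n" using p yz lab unfolding labelling_def by auto
        then show ?thesis using *(4) [of y z] links_less [OF yz] by auto
      qed
      then have cpl: "\<forall>p\<in>insert (v, w) V. \<forall>(y, z)\<in>links n cmp p. M' y = M' z" by auto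
      show "Q \<tau>'' (R', M')"
      proof (rule Q)
        show "labelling (insert (v, w) V) M'"
          using *(2) snd' cpl lab *(5) vw unfolding labelling_def by simp
        show "moves N M' \<mu>'" by fact
        show "\<tau>'' + 60 * \<mu> \<le> \<tau> + 60 * \<mu>' + 80" using *(6) \<tau>' by linarith
      qed (use R * in \<open>auto simp: addresses_def\<close>)
    qed (use R in auto)
    then show ?thesis
      using R 2 by (simp add: compare_com_def plus_cell_def addresses_def words logi
        push_bit_eq_mult flip: x1_def x2_def)
  qed
qed


section \<open>Lexicographic enumeration of the faces\<close>

definition visited :: "nat \<Rightarrow> nat \<Rightarrow> (nat \<times> nat) set" where
  "visited v w = {p \<in> face_pairs n. fst p < v \<or> fst p = v \<and> snd p < w}"

lemma finite_face_pairs: "finite (face_pairs n)"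
  by (rule finite_subset [OF _ finite_sub_pairs [of n]]) (auto simp: face_pairs_def)

lemma finite_visited: "finite (visited v w)"
  by (rule finite_subset [OF _ finite_face_pairs]) (auto simp: visited_def)

lemma card_visited: "card (visited v w) \<le> 3 ^ n"
proof -
  have "card (visited v w) \<le> card (sub_pairs n)"
    by (intro card_mono finite_sub_pairs) (auto simp: visited_def face_pairs_def)
  then show ?thesis using card_sub_pairs [of n] by linarith
qed

text \<open>No proper superset of \<open>v\<close> precedes \<open>(v + 1) OR v\<close>, so the
  initial jump misses no face.\<close>

lemma visited_first: "visited v ((v + 1) OR v) = visited v 0"
proof -
  have "\<not> w < (v + 1) OR v" if "(v, w) \<in> face_pairs n" for w
  proof -
    note vw = face_pairsD [OF that]
    have "v \<le> w" using vw(3) by (metis and_le_nat)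
    then show ?thesis using next_superset_least [of v v w] vw by (simp add: not_less)
  qed
  then show ?thesis unfolding visited_def by auto
qed

lemma visited_next:
  assumes "(v, w) \<in> face_pairs n"
  shows "visited v ((w + 1) OR v) = insert (v, w) (visited v w)"
proof -
  note vw = face_pairsD [OF assms]
  have "u < (w + 1) OR v \<longleftrightarrow> u \<le> w" if "(v, u) \<in> face_pairs n" for u
    using next_superset_least [of v w u] next_superset(2) [of w v] vw face_pairsD [OF that]
    by (meson leD le_less_trans not_le)
  then show ?thesis unfolding visited_def using assms by force
qed

lemma visited_last: "2 ^ n \<le> w \<Longrightarrow> visited v w = visited (v + 1) 0"
  unfolding visited_def by (auto dest: face_pairsD)

lemma visited_all: "visited (2 ^ n) 0 = face_pairs n"
  unfolding visited_def by (auto dest: face_pairsD)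

text \<open>The number of visited faces serves as a clock; with \<open>card_visited\<close> it turns
  into the \<open>3 ^ n\<close> term.\<close>

definition progress :: "nat \<Rightarrow> nat \<Rightarrow> nat \<Rightarrow> nat \<Rightarrow> (nat \<Rightarrow> nat) \<Rightarrow> bool" where
  "progress \<tau> v w \<tau>' M \<longleftrightarrow> (\<exists>\<mu>. labelling (visited v w) M \<and> moves N M \<mu> \<and>
     \<tau>' \<le> \<tau> + 100 * card (visited v w) + 40 * v + 60 * \<mu>)"

lemma progress_bound:
  assumes "progress \<tau> v w \<tau>' M" "v \<le> 2 ^ n"
  shows "\<tau>' \<le> \<tau> + 100 * 3 ^ n + 40 * 2 ^ n + 60 * (N * (2 * n))"
proof -
  obtain \<mu> where "moves N M \<mu>" "\<tau>' \<le> \<tau> + 100 * card (visited v w) + 40 * v + 60 * \<mu>"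
    using assms(1) unfolding progress_def by blast
  moreover have "\<mu> \<le> N * (2 * n)"
    using moves_bound [OF \<open>moves N M \<mu>\<close>] N_le unfolding K_def by blast
  ultimately show ?thesis using assms(2) card_visited [of v w] by linarith
qed

lemma next_word: "v < 2 ^ n \<Longrightarrow> take_bit b v = v" "v < 2 ^ n \<Longrightarrow> take_bit b (Suc v) = Suc v"
  using pow_le_K K_pos by (auto intro!: word)

lemma wp_superset_loop:
  assumes R: "addresses R" "R 6 = v" "R 7 = (v + 1) OR v" and v: "v < 2 ^ n"
    and M: "progress \<sigma> v 0 \<tau> M"
    and Q: "\<And>\<tau>' R' M'. addresses R' \<Longrightarrow> R' 6 = v \<Longrightarrow>
      progress \<sigma> (v + 1) 0 (\<tau>' + 30) M' \<Longrightarrow> Q \<tau>' (R', M')"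
  shows "wp b cmp (While (Less (Reg 7) (Reg 1)) (Seq compare_com next_com)) Q \<tau> (R, M)"
proof -
  define I where "I \<tau>' s \<longleftrightarrow> addresses (fst s) \<and> fst s 6 = v \<and> v AND fst s 7 = v \<and> v < fst s 7 \<and>
     progress \<sigma> v (fst s 7) \<tau>' (snd s)" for \<tau>' and s :: state
  show ?thesis
  proof (rule wp_While [where I = I])
    show "I \<tau> (R, M)"
      using R M next_superset [of v v] by (simp add: I_def progress_def visited_first [simplified])
  next
    fix \<tau>' s assume "I \<tau>' s"
    then show "\<tau>' \<le> \<sigma> + 100 * 3 ^ n + 40 * 2 ^ n + 60 * (N * (2 * n))"
      using progress_bound [of \<sigma> v] v unfolding I_def by force
  next
    fix \<tau>' s assume I: "I \<tau>' s" and g: "test_val b s (Less (Reg 7) (Reg 1))"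
    obtain R' M' where s: "s = (R', M')" by force
    define w where "w = R' 7"
    have R': "addresses R'" "R' 6 = v" "R' 7 = w" using I by (auto simp: I_def s w_def)
    have w: "w < 2 ^ n" using g R' by (simp add: s addresses_def)
    have vw: "(v, w) \<in> face_pairs n"
      using I v w by (auto simp: I_def s w_def face_pairs_def sub_pairs_def)
    obtain \<mu> where \<mu>: "labelling (visited v w) M'" "moves N M' \<mu>"
        "\<tau>' \<le> \<sigma> + 100 * card (visited v w) + 40 * v + 60 * \<mu>"
      using I by (auto simp: I_def s w_def progress_def)
    have card: "card (visited v ((w + 1) OR v)) = Suc (card (visited v w))"
      unfolding visited_next [OF vw] using finite_visited
      by (intro card_insert_disjoint) (auto simp: visited_def)
    show "wp b cmp (Seq compare_com next_com) I (\<tau>' + test_time (Less (Reg 7) (Reg 1))) s"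
      unfolding wp_Seq s
    proof (rule wp_compare_com [OF R' vw \<mu>(1,2)])
      fix \<tau>'' R'' M'' \<mu>''
      assume *: "addresses R''" "R'' 6 = v" "R'' 7 = w" "labelling (insert (v, w) (visited v w)) M''"
        "moves N M'' \<mu>''"
        "\<tau>'' + 60 * \<mu> \<le> \<tau>' + test_time (Less (Reg 7) (Reg 1)) + 60 * \<mu>'' + 80"
      have "progress \<sigma> v ((w + 1) OR v) \<tau>2 M''" if "\<tau>2 \<le> \<tau>'' + 10" for \<tau>2
        unfolding progress_def
        by (rule exI [of _ \<mu>'']) (use * \<mu>(3) that card in \<open>simp add: visited_next [OF vw] flip: One_nat_def\<close>)
      moreover have "v < (w + 1) OR v"
        using next_superset(2) [of w v] I by (simp add: I_def s w_def)
      ultimately show "wp b cmp next_com I \<tau>'' (R'', M'')"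
        using * v w next_superset(1) [of v w]
        by (simp add: next_com_def I_def next_word)
    qed
  next
    fix \<tau>' s assume I: "I \<tau>' s" and g: "\<not> test_val b s (Less (Reg 7) (Reg 1))"
    obtain R' M' where s: "s = (R', M')" by force
    have "2 ^ n \<le> R' 7" using I g by (simp add: I_def s addresses_def)
    then have "visited v (R' 7) = visited (v + 1) 0" by (rule visited_last)
    \<comment> \<open>Passing from \<open>v\<close> to \<open>v + 1\<close> releases a credit of 40:
      it pays the last test and leaves 30 for the outer loop.\<close>
    then have "progress \<sigma> (v + 1) 0 (\<tau>' + test_time (Less (Reg 7) (Reg 1)) + 30) M'"
      using I unfolding I_def progress_def s by auto
    then show "Q (\<tau>' + test_time (Less (Reg 7) (Reg 1))) s"
      using I unfolding s by (intro Q) (auto simp: I_def)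
  qed
qed

lemma wp_faces_loop:
  assumes R: "addresses R" "R 6 = 0" and M: "labelling {} M" "moves N M 0"
    and Q: "\<And>\<tau>' s. labelling (face_pairs n) (snd s) \<Longrightarrow>
      \<tau>' \<le> \<tau> + 100 * 3 ^ n + 40 * 2 ^ n + 60 * (N * (2 * n)) + 3 \<Longrightarrow> Q \<tau>' s"
  shows "wp b cmp faces_loop Q \<tau> (R, M)"
proof -
  define I where "I \<tau>' s \<longleftrightarrow> addresses (fst s) \<and> fst s 6 \<le> 2 ^ n \<and>
     progress \<tau> (fst s 6) 0 \<tau>' (snd s)" for \<tau>' and s :: state
  have bound: "\<tau>' \<le> \<tau> + 100 * 3 ^ n + 40 * 2 ^ n + 60 * (N * (2 * n))" if "I \<tau>' s" for \<tau>' s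
    using that progress_bound unfolding I_def by blast
  show ?thesis
    unfolding faces_loop_def
  proof (rule wp_While [where I = I, OF _ _ bound])
    have "visited 0 0 = {}" by (simp add: visited_def)
    then show "I \<tau> (R, M)" using R M by (auto simp: I_def progress_def)
  next
    fix \<tau>' s assume I: "I \<tau>' s" and g: "test_val b s (Less (Reg 6) (Reg 1))"
    obtain R' M' where s: "s = (R', M')" by force
    define v where "v = R' 6"
    have R': "addresses R'" "R' 6 = v" using I by (auto simp: I_def s v_def)
    have v: "v < 2 ^ n" using g R' by (simp add: s addresses_def)
    have "progress \<tau> v 0 \<tau>' M'" using I by (simp add: I_def s v_def)
    have loop: "wp b cmp (While (Less (Reg 7) (Reg 1)) (Seq compare_com next_com))
        (wp b cmp (Assign 6 (Bin Plus (Reg 6) (Lit 1))) I) \<tau>'' (R'(7 := Suc v OR v), M')"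
      if "\<tau>'' \<le> \<tau>' + 20" for \<tau>''
    \<comment> \<open>Moving the base time by 20 pays for entering the inner loop. The returned 30
      repay this and leave 10 for the increment of \<open>v\<close>.\<close>
    proof (rule wp_superset_loop [where v = v and \<sigma> = "\<tau> + 20"])
      show "progress (\<tau> + 20) v 0 \<tau>'' M'"
        using I that unfolding I_def s v_def progress_def by auto
      fix \<tau>2 R2 M2
      assume *: "addresses R2" "R2 6 = v" "progress (\<tau> + 20) (v + 1) 0 (\<tau>2 + 30) M2"
      have "progress \<tau> (v + 1) 0 \<tau>3 M2" if "\<tau>3 \<le> \<tau>2 + 10" for \<tau>3
        using *(3) that unfolding progress_def by auto
      then show "wp b cmp (Assign 6 (Bin Plus (Reg 6) (Lit 1))) I \<tau>2 (R2, M2)"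
        using * v by (simp add: I_def next_word)
    qed (use R' v in auto)
    then show "wp b cmp (Seq (Assign 7 (Reg 6)) (Seq next_com
        (Seq (While (Less (Reg 7) (Reg 1)) (Seq compare_com next_com))
          (Assign 6 (Bin Plus (Reg 6) (Lit 1))))))
        I (\<tau>' + test_time (Less (Reg 6) (Reg 1))) s"
      using R' v by (simp add: s next_com_def next_word)
  next
    fix \<tau>' s assume I: "I \<tau>' s" and g: "\<not> test_val b s (Less (Reg 6) (Reg 1))"
    then have "fst s 6 = 2 ^ n" by (auto simp: I_def addresses_def)
    then have "labelling (face_pairs n) (snd s)"
      using I visited_all by (auto simp: I_def progress_def)
    then show "Q (\<tau>' + test_time (Less (Reg 6) (Reg 1))) s"
      using bound [OF I] by (intro Q) auto
  qed
qed


section \<open>Initialisation and the complete run\<close>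

lemma wp_log_loop:
  assumes R: "addresses R" "R 12 = 0"
    and Q: "\<And>\<tau>' R' M'. addresses R' \<Longrightarrow> R' 6 = R 6 \<Longrightarrow> (\<forall>i<n. M' (4 * K + 2 ^ i) = i) \<Longrightarrow>
      \<tau>' \<le> \<tau> + 20 * n + 3 \<Longrightarrow> Q \<tau>' (R', M')"
  shows "wp b cmp log_loop Q \<tau> (R, M)"
proof -
  define I where "I \<tau>' s \<longleftrightarrow> addresses (fst s) \<and> fst s 6 = R 6 \<and> fst s 12 \<le> n \<and>
     (\<forall>i<fst s 12. snd s (4 * K + 2 ^ i) = i) \<and> \<tau>' \<le> \<tau> + 20 * fst s 12" for \<tau>' and s :: state
  show ?thesis
    unfolding log_loop_def
  proof (rule wp_While [where I = I])
    show "I \<tau> (R, M)" using R by (simp add: I_def)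
  next
    fix \<tau>' s assume "I \<tau>' s"
    then show "\<tau>' \<le> \<tau> + 20 * n" by (auto simp: I_def)
  next
    fix \<tau>' s assume I: "I \<tau>' s" and g: "test_val b s (Less (Reg 12) (Reg 0))"
    obtain R' M' where s: "s = (R', M')" by force
    define i where "i = R' 12"
    have R': "addresses R'" "R' 12 = i" "R' 6 = R 6" "\<tau>' \<le> \<tau> + 20 * i"
      using I by (auto simp: I_def s i_def)
    have tab: "M' (4 * K + 2 ^ j) = j" if "j < i" for j using I that by (simp add: I_def s i_def)
    have i: "i < n" using g R' by (simp add: s addresses_def)
    have pow: "(2 :: nat) ^ i < K"
      using less_le_trans [OF pow_less [OF i] pow_le_K] .
    then have "(2 :: nat) ^ i < 2 ^ b" using b unfolding K_def by linarith
    then have words: "i < b" "take_bit b (4 * K + 2 ^ i) = 4 * K + 2 ^ i" "take_bit b (Suc i) = Suc i"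
      using pow i n_less_K by (auto intro!: word)
    have "I \<tau>2 (R'(12 := Suc i), M'(4 * K + 2 ^ i := i))" if "\<tau>2 \<le> \<tau>' + 20" for \<tau>2
      using R' tab i that by (auto simp: I_def less_Suc_eq)
    then show "wp b cmp (Seq (Write (Bin Plus (Reg 5) (Bin ShiftLeft (Lit 1) (Reg 12))) (Reg 12))
        (Assign 12 (Bin Plus (Reg 12) (Lit 1)))) I (\<tau>' + test_time (Less (Reg 12) (Reg 0))) s"
      using R' words by (simp add: s addresses_def push_bit_eq_mult)
  next
    fix \<tau>' s assume I: "I \<tau>' s" and g: "\<not> test_val b s (Less (Reg 12) (Reg 0))"
    obtain R' M' where s: "s = (R', M')" by force
    have "R' 12 = n" using I g by (auto simp: I_def s addresses_def)
    then show "Q (\<tau>' + test_time (Less (Reg 12) (Reg 0))) s"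
      using I unfolding s by (intro Q) (auto simp: I_def)
  qed
qed

lemma wp_singletons_loop:
  assumes R: "addresses R" "R 11 = N" "R 12 = 0" and logs: "\<forall>i<n. M (4 * K + 2 ^ i) = i"
    and Q: "\<And>\<tau>' R' M'. addresses R' \<Longrightarrow> R' 6 = R 6 \<Longrightarrow> labelling {} M' \<Longrightarrow> moves N M' 0 \<Longrightarrow>
      \<tau>' \<le> \<tau> + 30 * N + 3 \<Longrightarrow> Q \<tau>' (R', M')"
  shows "wp b cmp singletons_loop Q \<tau> (R, M)"
proof -
  define I where "I \<tau>' s \<longleftrightarrow> addresses (fst s) \<and> fst s 6 = R 6 \<and> fst s 11 = N \<and> fst s 12 \<le> N \<and>
     (\<forall>x<fst s 12. snd s x = x \<and> snd s (K + x) = x \<and> snd s (3 * K + x) = 1) \<and>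
     (\<forall>i<n. snd s (4 * K + 2 ^ i) = i) \<and> \<tau>' \<le> \<tau> + 30 * fst s 12" for \<tau>' and s :: state
  show ?thesis
    unfolding singletons_loop_def
  proof (rule wp_While [where I = I])
    show "I \<tau> (R, M)" using R logs by (simp add: I_def)
  next
    fix \<tau>' s assume "I \<tau>' s"
    then show "\<tau>' \<le> \<tau> + 30 * N" by (auto simp: I_def)
  next
    fix \<tau>' s assume I: "I \<tau>' s" and g: "test_val b s (Less (Reg 12) (Reg 11))"
    obtain R' M' where s: "s = (R', M')" by force
    define x where "x = R' 12"
    have R': "addresses R'" "R' 12 = x" "R' 11 = N" "R' 6 = R 6" "\<tau>' \<le> \<tau> + 30 * x"
      using I by (auto simp: I_def s x_def)
    have old: "M' y = y \<and> M' (K + y) = y \<and> M' (3 * K + y) = 1" if "y < x" for y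
      using I that by (simp add: I_def s x_def)
    have logs': "M' (4 * K + 2 ^ i) = i" if "i < n" for i using I that by (simp add: I_def s)
    have x: "x < N" using g R' by (simp add: s)
    then have xK: "x < K" using N_le by simp
    have words: "take_bit b (K + x) = K + x" "take_bit b (3 * K + x) = 3 * K + x"
        "take_bit b (Suc x) = Suc x"
      using xK by (auto intro!: word)
    have "I \<tau>2 (R'(12 := Suc x), M'(x := x, K + x := x, 3 * K + x := 1))"
      if "\<tau>2 \<le> \<tau>' + 30" for \<tau>2
      using R' old logs' x xK that by (auto simp: I_def less_Suc_eq)
    then show "wp b cmp (Seq (Write (Reg 12) (Reg 12)) (Seq (Write (plus_cell 2 12) (Reg 12))
        (Seq (Write (plus_cell 4 12) (Lit 1)) (Assign 12 (Bin Plus (Reg 12) (Lit 1))))))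
        I (\<tau>' + test_time (Less (Reg 12) (Reg 11))) s"
      using R' words by (simp add: s addresses_def plus_cell_def)
  next
    fix \<tau>' s assume I: "I \<tau>' s" and g: "\<not> test_val b s (Less (Reg 12) (Reg 11))"
    obtain R' M' where s: "s = (R', M')" by force
    have N: "R' 12 = N" using I g by (auto simp: I_def s)
    then have id: "M' x = x" "M' (K + x) = x" "M' (3 * K + x) = 1" if "x < N" for x
      using I that by (simp_all add: I_def s)
    have "\<exists>xs. chain (\<lambda>x. M' (2 * K + x)) (M' (K + l)) xs \<and> distinct xs \<and>
        set xs = {x. x < N \<and> M' x = l} \<and> M' (3 * K + l) = length xs" if "l < N" for l
      using id that by (intro exI [of _ "[l]"]) auto
    then have "quick_find K N M'" using id by (simp add: quick_find_def)
    then have "labelling {} M'" using I id by (simp add: labelling_def sound_iff I_def s)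
    moreover have "moves N M' 0"
    proof -
      have "1 \<le> card {y. y < N \<and> M' y = M' x}" if "x < N" for x
        using card_mono [of "{y. y < N \<and> M' y = M' x}" "{x}"] that by simp
      then show ?thesis unfolding moves_def by (intro exI [of _ "\<lambda>_. 0"]) simp
    qed
    ultimately show "Q (\<tau>' + test_time (Less (Reg 12) (Reg 11))) s"
      using I N unfolding s by (intro Q) (auto simp: I_def)
  qed
qed

lemma wp_phases_com:
  "wp b cmp phases_com (\<lambda>\<tau> s. \<tau> \<le> time_bound n \<and> sound n cmp (snd s) \<and>
     (\<forall>p\<in>face_pairs n. \<forall>(x, y)\<in>links n cmp p. snd s x = snd s y)) 0 (initial_state b n)"
proof -
  let ?Q = "\<lambda>\<tau> s. \<tau> \<le> time_bound n \<and> sound n cmp (snd s) \<and>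
     (\<forall>p\<in>face_pairs n. \<forall>(x, y)\<in>links n cmp p. snd s x = snd s y)"
  \<comment> \<open>The numbers 95, 90 and 70 here and below are cumulative budgets, chosen
    backwards so that the constant costs stay below the 100 in \<open>time_bound\<close>.\<close>
  have faces: "wp b cmp faces_loop ?Q \<tau> (R, M)"
    if "addresses R" "R 6 = 0" "labelling {} M" "moves N M 0" "\<tau> \<le> 95 + 20 * n + 30 * N" for \<tau> R M
    using that(5) by (intro wp_faces_loop that(1-4)) (simp_all add: labelling_def time_bound_def N_def)
  have singletons: "wp b cmp singletons_loop (wp b cmp faces_loop ?Q) \<tau> (R, M)"
    if "addresses R" "R 11 = N" "R 12 = 0" "R 6 = 0" "\<forall>i<n. M (4 * K + 2 ^ i) = i"
      "\<tau> \<le> 90 + 20 * n" for \<tau> R M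
    using that(4,6) by (intro wp_singletons_loop that(1-3,5) faces) auto
  have wn: "take_bit b n = n" "take_bit b N = N"
    using n_less_K N_le by (auto intro!: word)
  have logs: "wp b cmp log_loop (wp b cmp (Assign 12 (Lit 0))
      (wp b cmp (Assign 11 (Bin ShiftLeft (Reg 0) (Reg 0)))
      (wp b cmp singletons_loop (wp b cmp faces_loop ?Q)))) \<tau> (R, M)"
    if R: "addresses R" "R 12 = 0" "R 6 = 0" "\<tau> \<le> 70" for \<tau> R M
  proof (rule wp_log_loop [OF R(1,2)])
    fix \<tau>' R' M'
    assume *: "addresses R'" "R' 6 = R 6" "\<forall>i<n. M' (4 * K + 2 ^ i) = i" "\<tau>' \<le> \<tau> + 20 * n + 3"
    have "wp b cmp singletons_loop (wp b cmp faces_loop ?Q) \<tau>2 (R'(12 := 0, 11 := N), M')"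
      if "\<tau>2 \<le> \<tau>' + 10" for \<tau>2
      by (rule singletons) (use * R that in simp_all)
    moreover have "R' 0 = n" using * by (simp add: addresses_def)
    ultimately show "wp b cmp (Assign 12 (Lit 0)) (wp b cmp (Assign 11 (Bin ShiftLeft (Reg 0) (Reg 0)))
        (wp b cmp singletons_loop (wp b cmp faces_loop ?Q))) \<tau>' (R', M')"
      by (simp add: push_bit_eq_mult wn flip: N_def)
  qed
  have "(2 :: nat) ^ n < 2 ^ b" using b pow_le_K K_pos unfolding K_def by linarith
  then have "n < b" by simp
  have K: "2 ^ n * 2 ^ n = K" by (simp add: K_def power_add mult_2)
  have sums: "K + K = 2 * K" "2 * K + K = 3 * K" "3 * K + K = 4 * K" by simp_all
  have words: "take_bit b K = K" "take_bit b (2 * K) = 2 * K" "take_bit b (3 * K) = 3 * K"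
      "take_bit b (4 * K) = 4 * K"
    using K_pos by (auto intro!: word)
  have seq: "wp b cmp (Seq c1 c2) Q = wp b cmp c1 (wp b cmp c2 Q)" for c1 c2 Q
    by (intro ext) simp
  show ?thesis
    unfolding phases_com_def constants_com_def seq initial_state_def
    by (auto simp: plus_cell_def push_bit_eq_mult wn \<open>n < b\<close> K sums words addresses_def
        intro!: logs)
qed

end

section \<open>Vertices as sets of coordinates\<close>

definition vec :: "nat \<Rightarrow> nat set \<Rightarrow> bool list" where
  "vec n X = map (\<lambda>j. j \<in> X) [0..<n]"

definition coords :: "nat \<Rightarrow> bool list \<Rightarrow> nat set" where
  "coords n v = {j. j < n \<and> v ! j}"

lemma vec_nth [simp]: "j < n \<Longrightarrow> vec n X ! j \<longleftrightarrow> j \<in> X"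
  by (simp add: vec_def)

lemma length_vec [simp]: "length (vec n X) = n"
  by (simp add: vec_def)

lemma vec_coords [simp]: "length v = n \<Longrightarrow> vec n (coords n v) = v"
  by (auto simp: vec_def coords_def intro: nth_equalityI)

lemma coords_subset [simp]: "coords n v \<subseteq> {..<n}"
  by (auto simp: coords_def)

lemma coords_vec [simp]: "X \<subseteq> {..<n} \<Longrightarrow> coords n (vec n X) = X"
  by (auto simp: coords_def)

lemma vertex_of_eq_vec: "vertex_of n x = vec n {j. bit x j}"
  by (simp add: vertex_of_def vec_def)

text \<open>The face string has stars on \<open>D\<close> and the bits of \<open>B\<close>
  elsewhere; its sink \<open>v\<close> corresponds to
  \<open>X = coords n v \<inter> D\<close>.\<close>

lemma uso_unique_sink:
  assumes uso: "is_uso n out" and B: "B \<subseteq> {..<n}" and D: "D \<subseteq> {..<n} - B"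
  shows "\<exists>!X. X \<subseteq> D \<and> coords n (out (vec n (B \<union> X))) \<inter> D = {}"
proof -
  define f where "f = map (\<lambda>j. if j \<in> D then None else Some (j \<in> B)) [0..<n]"
  have f: "f ! j = (if j \<in> D then None else Some (j \<in> B))" if "j < n" for j
    using that by (simp add: f_def)
  have sink: "v \<in> face_vertices n f \<and> (\<forall>i<n. f ! i = None \<longrightarrow> \<not> out v ! i) \<longleftrightarrow>
      length v = n \<and> (\<forall>j<n. j \<notin> D \<longrightarrow> (v ! j \<longleftrightarrow> j \<in> B)) \<and> coords n (out v) \<inter> D = {}" for v
    using D by (auto simp: face_vertices_def cube_def f coords_def split: if_splits)
  have "length f = n" by (simp add: f_def)
  then have "\<exists>!v. v \<in> face_vertices n f \<and> (\<forall>i<n. f ! i = None \<longrightarrow> \<not> out v ! i)"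
    using uso unfolding is_uso_def by simp
  then have "\<exists>!v. length v = n \<and> (\<forall>j<n. j \<notin> D \<longrightarrow> (v ! j \<longleftrightarrow> j \<in> B)) \<and> coords n (out v) \<inter> D = {}"
    unfolding sink .
  then obtain v where v: "length v = n" "\<forall>j<n. j \<notin> D \<longrightarrow> (v ! j \<longleftrightarrow> j \<in> B)"
      "coords n (out v) \<inter> D = {}"
    and unique: "\<And>u. length u = n \<Longrightarrow> \<forall>j<n. j \<notin> D \<longrightarrow> (u ! j \<longleftrightarrow> j \<in> B) \<Longrightarrow>
      coords n (out u) \<inter> D = {} \<Longrightarrow> u = v"
    by metis
  have v_eq: "B \<union> (coords n v \<inter> D) = coords n v"
    using v(2) B D by (auto simp: coords_def)
  show ?thesis
  proof (rule ex1I [of _ "coords n v \<inter> D"])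
    show "coords n v \<inter> D \<subseteq> D \<and> coords n (out (vec n (B \<union> (coords n v \<inter> D)))) \<inter> D = {}"
      using v by (simp add: v_eq)
    fix X assume X: "X \<subseteq> D \<and> coords n (out (vec n (B \<union> X))) \<inter> D = {}"
    then have "vec n (B \<union> X) = v" by (intro unique) auto
    then have "coords n v = B \<union> X"
      using X B D by (metis Diff_subset coords_vec le_sup_iff order_trans)
    then show "X = coords n v \<inter> D" using X D by blast
  qed
qed

lemma uso_distinguishes:
  assumes "is_uso n out" "V \<subseteq> {..<n}" "W \<subseteq> {..<n}" "V \<noteq> W"
  shows "\<exists>k\<in>{..<n}. (k \<in> V) \<noteq> (k \<in> W) \<and> (k \<in> coords n (out (vec n V))) \<noteq> (k \<in> coords n (out (vec n W)))"
  using outmaps_distinguish [where out = "\<lambda>X. coords n (out (vec n X))" and K = "{..<n}",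
      OF uso_unique_sink [OF assms(1)] _ assms(2-4)] by simp

lemma certifies_vec:
  "certifies n out i (vec n V) (vec n W) \<longleftrightarrow> (\<forall>k<n. k \<noteq> i \<and> (k \<in> V) \<noteq> (k \<in> W) \<longrightarrow>
     (k \<in> coords n (out (vec n V)) \<longleftrightarrow> k \<in> coords n (out (vec n W))))"
  by (auto simp: certifies_def coords_def)

lemma bits_subset: "x < 2 ^ n \<Longrightarrow> {j. bit (x :: nat) j} \<subseteq> {..<n}"
  by (metis (no_types, lifting) bit_take_bit_iff lessThan_iff mem_Collect_eq subsetI
      take_bit_nat_eq_self)

definition word :: "nat \<Rightarrow> nat set \<Rightarrow> nat" where
  "word n X = word_of (vec n X)"

lemma bit_word: "bit (word n X) j \<longleftrightarrow> j < n \<and> j \<in> X"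
  by (auto simp: word_def bit_word_of)

lemma word_less: "word n X < 2 ^ n"
proof -
  have "take_bit n (word n X) = word n X"
    by (rule bit_eqI) (auto simp: bit_take_bit_iff bit_word)
  then show ?thesis by (simp add: take_bit_nat_eq_self_iff)
qed

lemma vertex_of_word [simp]: "vertex_of n (word n X) = vec n X"
  by (auto simp: vertex_of_def vec_def bit_word)

lemma word_bits: "x < 2 ^ n \<Longrightarrow> word n {j. bit x j} = x"
  using bits_subset by (intro bit_eqI) (auto simp: bit_word)

lemma word_remove:
  assumes "i \<in> X" "i < n"
  shows "word n X - 2 ^ i = word n (X - {i})"
proof -
  have "word n (X - {i}) AND 2 ^ i = 0"
    by (rule bit_eqI) (auto simp: bit_simps bit_word)
  then have "word n (X - {i}) + 2 ^ i = word n (X - {i}) OR 2 ^ i"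
    by (rule disjunctive_add_eq_or)
  also have "\<dots> = word n X"
    by (rule bit_eqI) (use assms in \<open>auto simp: bit_simps bit_word\<close>)
  finally show ?thesis by linarith
qed

lemma word_inj: "word n X = word n Y \<Longrightarrow> X \<subseteq> {..<n} \<Longrightarrow> Y \<subseteq> {..<n} \<Longrightarrow> X = Y"
  by (metis coords_vec vertex_of_word)

text \<open>The coordinate \<open>k\<close> from \<open>uso_distinguishes\<close> violates every
  certificate for a coordinate other than \<open>k\<close>. Hence the mask has at most bit
  \<open>k\<close>, and the two vertices differ there.\<close>

lemma compare_eq_exp_iff:
  assumes uso: "is_uso n out" and vw: "v < 2 ^ n" "w < 2 ^ n" "v \<noteq> w" and i: "i < n"
  shows "compare_vertices n out v w = 2 ^ i \<longleftrightarrow> certifies n out i (vertex_of n v) (vertex_of n w)"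
    and "certifies n out i (vertex_of n v) (vertex_of n w) \<Longrightarrow> bit v i \<noteq> bit w i"
proof -
  have bit: "bit (compare_vertices n out v w) j \<longleftrightarrow>
      j < n \<and> certifies n out j (vertex_of n v) (vertex_of n w)" for j
    by (auto simp: compare_vertices_def bit_word_of)
  have "{j. bit v j} \<noteq> {j. bit w j}" using vw(3) by (metis bit_eq_iff mem_Collect_eq)
  then obtain k where k: "k < n" "bit v k \<noteq> bit w k"
      "(k \<in> coords n (out (vertex_of n v))) \<noteq> (k \<in> coords n (out (vertex_of n w)))"
    using uso_distinguishes [OF uso bits_subset [OF vw(1)] bits_subset [OF vw(2)]]
    by (auto simp: vertex_of_eq_vec)
  have only_k: "j = k" if "certifies n out j (vertex_of n v) (vertex_of n w)" for j
    using that k unfolding vertex_of_eq_vec certifies_vec by auto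
  show "bit v i \<noteq> bit w i" if "certifies n out i (vertex_of n v) (vertex_of n w)"
    using only_k [OF that] k by simp
  show "compare_vertices n out v w = 2 ^ i \<longleftrightarrow> certifies n out i (vertex_of n v) (vertex_of n w)"
  proof
    assume "compare_vertices n out v w = 2 ^ i"
    then show "certifies n out i (vertex_of n v) (vertex_of n w)"
      using bit [of i] by (simp add: bit_exp_iff)
  next
    assume c: "certifies n out i (vertex_of n v) (vertex_of n w)"
    show "compare_vertices n out v w = 2 ^ i"
      by (rule bit_eqI) (use only_k c i in \<open>auto simp: bit bit_exp_iff\<close>)
  qed
qed

lemma compare_vertices_cases:
  assumes uso: "is_uso n out" and vw: "v < 2 ^ n" "w < 2 ^ n" "v AND w = v" "v \<noteq> w"
  shows "compare_vertices n out v w = 0 \<or>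
    (\<exists>i<n. compare_vertices n out v w = 2 ^ i \<and> bit w i \<and> \<not> bit v i)"
proof (cases "\<exists>i<n. certifies n out i (vertex_of n v) (vertex_of n w)")
  case True
  then obtain i where i: "i < n" "certifies n out i (vertex_of n v) (vertex_of n w)" by blast
  have "bit v i \<Longrightarrow> bit w i" using vw(3) by (metis bit_and_iff)
  then show ?thesis using compare_eq_exp_iff [OF uso vw(1,2,4) i(1)] i by auto
next
  case False
  have "compare_vertices n out v w = 0"
    by (rule bit_eqI) (use False in \<open>auto simp: compare_vertices_def bit_word_of\<close>)
  then show ?thesis by simp
qed

section \<open>Edges\<close>

definition edge :: "nat \<Rightarrow> nat \<Rightarrow> nat set \<Rightarrow> bool list set" where
  "edge n i X = {vec n (X - {i}), vec n (insert i X)}"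

lemma edge_in_i_edges: "i < n \<Longrightarrow> edge n i X \<in> i_edges n i"
  unfolding i_edges_def edge_def
  by (rule CollectI, intro exI conjI, rule refl) (auto simp: cube_def differ_exactly_def)

lemma vec_in_edge: "vec n X \<in> edge n i X"
  by (cases "i \<in> X") (auto simp: edge_def insert_absorb)

lemma i_edge_eq:
  assumes "e \<in> i_edges n i" "v \<in> e" "i < n"
  shows "e = edge n i (coords n v)" "length v = n"
proof -
  obtain u w where uw: "e = {u, w}" "length u = n" "length w = n" "differ_exactly n i u w"
    using assms(1) unfolding i_edges_def cube_def by blast
  have flip: "{v, w} = edge n i (coords n v)"
    if "length v = n" "length w = n" "differ_exactly n i v w" for v w
  proof -
    have w: "w = vec n {j. j < n \<and> (v ! j \<noteq> (j = i))}"
      using that by (intro nth_equalityI) (auto simp: differ_exactly_def)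
    have v: "v = vec n (coords n v)" using that by simp
    show ?thesis
    proof (cases "v ! i")
      case True
      then have "{j. j < n \<and> (v ! j \<noteq> (j = i))} = coords n v - {i}" "insert i (coords n v) = coords n v"
        using assms(3) by (auto simp: coords_def)
      then show ?thesis using v w unfolding edge_def by auto
    next
      case False
      then have "{j. j < n \<and> (v ! j \<noteq> (j = i))} = insert i (coords n v)" "coords n v - {i} = coords n v"
        using assms(3) by (auto simp: coords_def)
      then show ?thesis using v w unfolding edge_def by auto
    qed
  qed
  have "differ_exactly n i w u" using uw(4) unfolding differ_exactly_def by metis
  then show "e = edge n i (coords n v)"
    using uw assms(2) flip [of u w] flip [of w u] by auto
  show "length v = n" using uw assms(2) by auto
qed

lemma low_end:
  assumes "v \<in> edge n i X" "\<not> v ! i" "i < n"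
  shows "v = vec n (X - {i})"
  using assms by (auto simp: edge_def)

lemma edge_remove: "edge n i (X - {i}) = edge n i X"
  by (simp add: edge_def)

lemma edge_eqD:
  assumes "edge n i X = edge n i Y" "i < n" "X \<subseteq> {..<n}" "Y \<subseteq> {..<n}"
  shows "X - {i} = Y - {i}"
proof -
  have "vec n (X - {i}) \<in> edge n i Y" using assms(1) by (auto simp: edge_def)
  then have "vec n (X - {i}) = vec n (Y - {i})" using low_end assms(2) by fastforce
  then show ?thesis using assms(3,4) coords_vec by (metis Diff_subset order_trans)
qed

lemma same_label_iff:
  assumes "i < n"
  shows "(edge n i X, edge n i Y) \<in> same_label n s i \<longleftrightarrow>
    snd s (i * 2 ^ n + word n (X - {i})) = snd s (i * 2 ^ n + word n (Y - {i}))"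
proof -
  have low: "vec n (Z - {i}) \<in> edge n i Z" "\<not> vec n (Z - {i}) ! i" for Z
    using assms by (auto simp: edge_def)
  show ?thesis
    unfolding same_label_def word_def
    using edge_in_i_edges [OF assms] low low_end [OF _ _ assms] by blast
qed

section \<open>Correctness\<close>

text \<open>Equal labels give phases by applying soundness to the predicate of being in phase with
  the edge at \<open>X\<close>. Conversely, sharing the label of \<open>X\<close> is closed under
  least-greatest certificates, hence under all certificates, hence along every path.\<close>

lemma in_phase_iff_same_label:
  assumes uso: "is_uso n out" and i: "i < n"
    and complete: "\<And>p x y. p \<in> face_pairs n \<Longrightarrow> (x, y) \<in> links n (compare_vertices n out) p \<Longrightarrow> M x = M y"
    and sound: "sound n (compare_vertices n out) M"
    and XY: "X \<subseteq> {..<n}" "Y \<subseteq> {..<n}"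
  shows "M (i * 2 ^ n + word n (X - {i})) = M (i * 2 ^ n + word n (Y - {i})) \<longleftrightarrow>
    (edge n i X, edge n i Y) \<in> in_phase n out i"
proof
  let ?key = "\<lambda>Z. i * 2 ^ n + word n (Z - {i})"
  assume eq: "M (?key X) = M (?key Y)"
  note equiv = equiv_in_phase [of n i out]
  have refl: "(edge n i Z, edge n i Z) \<in> in_phase n out i" for Z
    using equiv edge_in_i_edges [OF i] unfolding equiv_def refl_on_def by blast
  define f where "f x \<longleftrightarrow> (\<exists>Z\<subseteq>{..<n}. x = ?key Z \<and> (edge n i X, edge n i Z) \<in> in_phase n out i)" for x
  have f_key: "f (?key Z) \<longleftrightarrow> (edge n i X, edge n i Z) \<in> in_phase n out i" if Z: "Z \<subseteq> {..<n}" for Z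
  proof
    assume "f (?key Z)"
    then obtain Z' where Z': "Z' \<subseteq> {..<n}" "word n (Z - {i}) = word n (Z' - {i})"
        "(edge n i X, edge n i Z') \<in> in_phase n out i"
      unfolding f_def by auto
    then have "Z - {i} = Z' - {i}" using Z by (intro word_inj) auto
    then have "edge n i Z = edge n i Z'" by (metis edge_remove)
    then show "(edge n i X, edge n i Z) \<in> in_phase n out i" using Z' by simp
  qed (use Z f_def in blast)
  have "f x = f y" if p: "p \<in> face_pairs n" and l: "(x, y) \<in> links n (compare_vertices n out) p" for p x y
  proof -
    obtain v w where vw: "p = (v, w)" "v < 2 ^ n" "w < 2 ^ n" "v \<noteq> w" "v AND w = v"
      using p unfolding face_pairs_def sub_pairs_def by (cases p) auto
    obtain j where j: "x = j * 2 ^ n + v" "y = j * 2 ^ n + (w - 2 ^ j)" "j < n"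
        "compare_vertices n out v w = 2 ^ j"
      using l unfolding links_def vw(1) by auto
    show ?thesis
    proof (cases "j = i")
      case False
      \<comment> \<open>Keys of coordinate \<open>j\<close> fill the block from
        \<open>j * 2 ^ n\<close> to \<open>(j + 1) * 2 ^ n - 1\<close>; division by
        \<open>2 ^ n\<close> separates the blocks, so \<open>f\<close> fails at both ends of a link
        of another coordinate.\<close>
      have "\<not> f (j * 2 ^ n + u)" if "u < 2 ^ n" for u
      proof
        assume "f (j * 2 ^ n + u)"
        then obtain Z where "j * 2 ^ n + u = ?key Z" unfolding f_def by blast
        then have "(j * 2 ^ n + u) div 2 ^ n = ?key Z div 2 ^ n" by simp
        then show False using that word_less [of n "Z - {i}"] False by simp
      qed
      then show ?thesis using j vw by simp
    next
      case True
      define V where "V = {j. bit v j}"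
      define W where "W = {j. bit w j}"
      have VW: "V \<subseteq> {..<n}" "W \<subseteq> {..<n}" "v = word n V" "w = word n W"
        using vw bits_subset word_bits unfolding V_def W_def by auto
      have cert: "certifies n out i (vec n V) (vec n W)"
        using compare_eq_exp_iff(1) [OF uso vw(2-4) i] j True by (simp add: vertex_of_eq_vec V_def W_def)
      have "bit v i \<noteq> bit w i"
        using compare_eq_exp_iff [OF uso vw(2-4) i] j True by simp
      moreover have "bit v i \<Longrightarrow> bit w i" using vw(5) by (metis bit_and_iff)
      ultimately have iVW: "i \<notin> V" "i \<in> W" by (auto simp: V_def W_def)
      then have "x = ?key V" "y = ?key W"
        using j True VW word_remove [OF iVW(2) i] by auto
      moreover have "(edge n i V, edge n i W) \<in> direct_phase n out i"
        unfolding direct_phase_def using edge_in_i_edges [OF i] vec_in_edge cert by blast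
      then have "(edge n i V, edge n i W) \<in> in_phase n out i"
        unfolding in_phase_def using edge_in_i_edges [OF i] by blast
      ultimately show ?thesis
        using f_key VW(1,2) equiv unfolding equiv_def by (meson symD transD)
    qed
  qed
  then have "\<forall>p\<in>face_pairs n. \<forall>(x, y)\<in>links n (compare_vertices n out) p. f x = f y" by auto
  then have "\<forall>x<n * 2 ^ n. \<forall>y<n * 2 ^ n. M x = M y \<longrightarrow> f x = f y"
    by (rule mp [OF spec [OF sound [unfolded sound_def], of f]])
  then have "f (?key X) = f (?key Y)"
    using eq key_less [OF i word_less] by simp
  then show "(edge n i X, edge n i Y) \<in> in_phase n out i"
    using f_key XY refl by blast
next
  let ?key = "\<lambda>Z. i * 2 ^ n + word n (Z - {i})"
  let ?out = "\<lambda>X. coords n (out (vec n X))"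
  assume "(edge n i X, edge n i Y) \<in> in_phase n out i"
  then have path: "(edge n i X, edge n i Y) \<in> (direct_phase n out i)\<^sup>*" by (simp add: in_phase_def)
  define S where "S Z \<longleftrightarrow> M (?key X) = M (?key Z)" for Z
  have S_remove: "S (Z - {i}) \<longleftrightarrow> S Z" for Z by (simp add: S_def)
  have closed: "S B \<longleftrightarrow> S (T - {i})" if BT: "B \<subseteq> T" "T \<subseteq> {..<n}" "i \<in> T - B"
      "\<forall>k\<in>T - B - {i}. k \<in> ?out B \<longleftrightarrow> k \<in> ?out T" for B T
  proof -
    have ne: "word n B \<noteq> word n T" using word_inj [of n B T] BT by blast
    have "word n B AND word n T = word n B"
      by (rule bit_eqI) (use BT(1) in \<open>auto simp: bit_and_iff bit_word\<close>)
    then have "(word n B, word n T) \<in> face_pairs n"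
      using ne word_less by (simp add: face_pairs_def sub_pairs_def)
    moreover have "certifies n out i (vec n B) (vec n T)"
      unfolding certifies_vec using BT by blast
    then have "compare_vertices n out (word n B) (word n T) = 2 ^ i"
      using compare_eq_exp_iff(1) [OF uso word_less word_less ne i] by simp
    then have "(i * 2 ^ n + word n B, i * 2 ^ n + (word n T - 2 ^ i)) \<in>
        links n (compare_vertices n out) (word n B, word n T)"
      using i by (auto simp: links_def)
    ultimately have "M (i * 2 ^ n + word n B) = M (i * 2 ^ n + (word n T - 2 ^ i))"
      by (rule complete)
    moreover have "B - {i} = B" using BT(3) by blast
    ultimately show ?thesis using word_remove [of i T n] BT(3) i by (simp add: S_def)
  qed
  \<comment> \<open>The quantifier over \<open>Z\<close> makes the claim depend on the edge alone,
    as \<open>Z\<close> and \<open>Z - {i}\<close> name the same edge.\<close>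
  from path have "\<forall>Z\<subseteq>{..<n}. e = edge n i Z \<longrightarrow> S Z" if "e = edge n i Y" for e
    unfolding that
  proof (induction rule: rtrancl_induct)
    case base
    show ?case using edge_eqD [OF _ i XY(1)] by (auto simp: S_def)
  next
    case (step e e')
    obtain v w where vw: "v \<in> e" "w \<in> e'" "certifies n out i v w" "e \<in> i_edges n i" "e' \<in> i_edges n i"
      using step.hyps(2) unfolding direct_phase_def by blast
    define V where "V = coords n v"
    define W where "W = coords n w"
    have VW: "V \<subseteq> {..<n}" "W \<subseteq> {..<n}" "e = edge n i V" "e' = edge n i W" "v = vec n V" "w = vec n W"
      using i_edge_eq [OF vw(4,1) i] i_edge_eq [OF vw(5,2) i] by (simp_all add: V_def W_def)
    have "S (V - {i}) \<longleftrightarrow> S (W - {i})"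
    proof (rule min_max_certificates_suffice [where K = "{..<n}" and out = ?out])
      show "k \<in> ?out V \<longleftrightarrow> k \<in> ?out W" if "k \<in> {..<n}" "k \<noteq> i" "(k \<in> V) \<noteq> (k \<in> W)" for k
        using vw(3) that unfolding VW(5,6) certifies_vec by blast
      show "\<exists>k\<in>{..<n}. (k \<in> A) \<noteq> (k \<in> B) \<and> (k \<in> ?out A) \<noteq> (k \<in> ?out B)"
        if "A \<subseteq> {..<n}" "B \<subseteq> {..<n}" "A \<noteq> B" for A B
        using uso_distinguishes [OF uso that] .
      show "S B \<longleftrightarrow> S (T - {i})" if "B \<subseteq> T" "T \<subseteq> {..<n}" "i \<in> T - B"
        "\<forall>k\<in>T - B - {i}. k \<in> ?out B \<longleftrightarrow> k \<in> ?out T" for B T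
        using that by (rule closed)
    qed (use VW in simp_all)
    then have "S W" using step.IH VW S_remove by blast
    then show ?case using edge_eqD [OF _ i VW(2)] S_remove VW(4) by metis
  qed
  then show "M (?key X) = M (?key Y)" using XY(2) unfolding S_def by blast
qed

lemma same_label_eq_in_phase:
  assumes "is_uso n out" "i < n"
    "\<And>p x y. p \<in> face_pairs n \<Longrightarrow> (x, y) \<in> links n (compare_vertices n out) p \<Longrightarrow> snd s x = snd s y"
    "sound n (compare_vertices n out) (snd s)"
  shows "same_label n s i = in_phase n out i"
proof -
  have edges: "\<exists>X\<subseteq>{..<n}. e = edge n i X" if e: "e \<in> i_edges n i" for e
  proof -
    obtain v where "v \<in> e" using e unfolding i_edges_def by blast
    then have "e = edge n i (coords n v)" using i_edge_eq(1) [OF e _ assms(2)] by blast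
    then show ?thesis using coords_subset by blast
  qed
  have iff: "(edge n i X, edge n i Y) \<in> same_label n s i \<longleftrightarrow> (edge n i X, edge n i Y) \<in> in_phase n out i"
    if "X \<subseteq> {..<n}" "Y \<subseteq> {..<n}" for X Y
    unfolding same_label_iff [OF assms(2)] by (rule in_phase_iff_same_label [OF assms that])
  have sub: "same_label n s i \<subseteq> i_edges n i \<times> i_edges n i" by (auto simp: same_label_def)
  have "in_phase n out i \<subseteq> i_edges n i \<times> i_edges n i"
    using equiv_in_phase [of n i out] by (simp add: equiv_def)
  then have "p \<in> same_label n s i \<longleftrightarrow> p \<in> in_phase n out i" for p
    using sub edges [of "fst p"] edges [of "snd p"] iff by (cases p) fastforce
  then show ?thesis by blast
qed

theorem mainTheorem3:
  shows "\<exists>(p :: com) (k :: nat) (time :: nat \<Rightarrow> nat) (comparisons :: nat \<Rightarrow> nat).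
    computes_all_phases p (\<lambda>n. k * (n + 1)) time comparisons \<and>
    (\<lambda>n. real (time n)) \<in> O(\<lambda>n. 3 ^ n) \<and>
    (\<lambda>n. real (comparisons n)) \<in> O(\<lambda>n. 3 ^ n)"
proof -
  \<comment> \<open>The word length suffices because
    \<open>8 * 2 ^ (2 * n) = 2 ^ (2 * n + 3)\<close>.\<close>
  have "computes_all_phases phases_com (\<lambda>n. 3 * (n + 1)) time_bound time_bound"
    unfolding computes_all_phases_def
  proof (intro allI impI)
    fix n out assume uso: "is_uso n out"
    let ?cmp = "compare_vertices n out"
    have "8 * 2 ^ (2 * n) = (2 :: nat) ^ (2 * n + 3)" by (simp add: power_add)
    also have "\<dots> \<le> 2 ^ (3 * (n + 1))" by (intro power_increasing) auto
    finally have "wp (3 * (n + 1)) ?cmp phases_com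
        (\<lambda>\<tau> s. \<tau> \<le> time_bound n \<and> sound n ?cmp (snd s) \<and>
          (\<forall>p\<in>face_pairs n. \<forall>(x, y)\<in>links n ?cmp p. snd s x = snd s y)) 0 (initial_state (3 * (n + 1)) n)"
      using compare_vertices_cases [OF uso] by (rule wp_phases_com)
    then obtain t q s where exec: "exec (3 * (n + 1)) ?cmp phases_com (initial_state (3 * (n + 1)) n) t q s"
      and t: "t \<le> time_bound n" and snd: "sound n ?cmp (snd s)"
      and complete: "\<forall>p\<in>face_pairs n. \<forall>(x, y)\<in>links n ?cmp p. snd s x = snd s y"
      unfolding wp_def by auto
    have "same_label n s i = in_phase n out i" if "i < n" for i
      using complete that snd by (intro same_label_eq_in_phase uso) auto
    then have "\<forall>i<n. output_partition n s i = phases n out i"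
      by (simp add: output_partition_def phases_def)
    then show "\<exists>t q s. exec (3 * (n + 1)) ?cmp phases_com (initial_state (3 * (n + 1)) n) t q s \<and>
        t \<le> time_bound n \<and> q \<le> time_bound n \<and> (\<forall>i<n. output_partition n s i = phases n out i)"
      using exec t comparisons_le_time [OF exec] by (meson order_trans)
  qed
  \<comment> \<open>The critical summand is the relabelling cost of order
    \<open>n\<^sup>2 * 2 ^ n\<close>, which \<open>3 ^ n\<close> dominates.\<close>
  moreover have "(\<lambda>n. real (time_bound n)) \<in> O(\<lambda>n. 3 ^ n)"
    unfolding time_bound_def by simp real_asymp
  ultimately show ?thesis by blast
qed

end
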